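(* Let $\mathbb{K}$ be a field and let $(\mathcal{O}, d^{\mathcal{O}})$ be a free cosimplicial $\Sigma$-dg operad over $\mathbb{K}$, i.e. a free pointed multiplicative symmetric differential graded operad, with multiplication $\mu\in(\mathcal{O}(2))_0$ and base point $1_0\in(\mathcal{O}(0))_0$ satisfying $\mu\circ_1 1_0=1_{\mathcal{O}}=\mu\circ_2 1_0$, together with its cosimplicial structure. Define the shuffle product $\nabla$ by, for $x\in(\mathcal{O}(p))_u$ and $y\in(\mathcal{O}(q))_v$, $$x\nabla y=\sum_{\sigma\in\Sigma_{(p,q)}}\mathrm{sgn}(\sigma)\,(x\odot y)\cdot\sigma^{-1}\in(\mathcal{O}(p+q))_{u+v},$$ where $\Sigma_{(p,q)}\subset\Sigma_{p+q}$ is the set of $(p,q)$-shuffles. Then $(\mathcal{O}, d^{\mathcal{O}})$ together with $\nabla$ is a differential graded algebra (called the twisted differential graded algebra).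
   Context: A $\Sigma$-dg operad $(\mathcal{O},d^{\mathcal{O}})$ over $\mathbb{K}$ is a symmetric operad in non-negatively graded chain complexes of $\mathbb{K}$-vector spaces: for each $n\ge 0$ a graded space $\mathcal{O}(n)=\bigoplus_{r\ge 0}(\mathcal{O}(n))_r$ with a right action of $\Sigma_n$ and a differential $d^{\mathcal{O}}:(\mathcal{O}(n))_r\to(\mathcal{O}(n))_{r-1}$, a unit $1_{\mathcal{O}}\in(\mathcal{O}(1))_0$ with $d^{\mathcal{O}}(1_{\mathcal{O}})=0$, and partial compositions $\circ_i:(\mathcal{O}(n))_r\otimes(\mathcal{O}(m))_l\to(\mathcal{O}(n+m-1))_{r+l}$ satisfying the usual unit, associativity (with Koszul signs in the internal degree $|\cdot|$) and equivariance axioms, with $d^{\mathcal{O}}(x\circ_i y)=d^{\mathcal{O}}(x)\circ_i y+(-1)^{|x|}x\circ_i d^{\mathcal{O}}(y)$ and $d^{\mathcal{O}}(x\cdot\sigma)=d^{\mathcal{O}}(x)\cdot\sigma$. The right action convention is that, for operations evaluated on inputs, $(x\cdot\sigma)(x_1,\dots,x_n)=x(x_{\sigma^{-1}(1)},\dots,x_{\sigma^{-1}(n)})$ (up to Koszul sign); correspondingly $(x\cdot\sigma)\circ_i(y\cdot\tau)=(x\circ_{\sigma(i)}y)\cdot \mathrm{sub}_i(\sigma,\tau)$, where for $\sigma\in\Sigma_n$, $\tau\in\Sigma_m$ in one-line notation $\mathrm{sub}_i(\sigma,\tau)\in\Sigma_{n+m-1}$ is obtained from $\sigma$ by replacing the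 entry $\sigma_i$ by the block $\sigma_i+\tau_1-1,\dots,\sigma_i+\tau_m-1$ and adding $m-1$ to each other entry larger than $\sigma_i$. Multiplicative: there is $\mu\in(\mathcal{O}(2))_0$ with $\mu\circ_1\mu=\mu\circ_2\mu$ and $d^{\mathcal{O}}(\mu)=0$. Pointed: there is an injective degree-zero chain map $\eta:\mathbb{K}\to\mathcal{O}(0)$; the base point is $1_0=\eta(1_{\mathbb{K}})$, and $d^{\mathcal{O}}(1_0)=0$. "Free" means that $\mathcal{O}$ comes with a collection of generators on which structure maps are defined and extended linearly; over a field every operad of vector spaces is regarded as freely generated in this sense by choosing a basis of each $(\mathcal{O}(n))_r$. The cosimplicial structure consists of $s_i(x)=x\circ_i 1_0$ ($1\le i\le n$) and $D_0(x)=\mu\circ_2x$, $D_i(x)=x\circ_i\mu$ ($1\le i\le n$), $D_{n+1}(x)=\mu\circ_1 x$ for $x\in\mathcal{O}(n)$. Product: for $x\in\mathcal{O}(p)$, $y\in\mathcal{O}(q)$, $x\odot y=\mu(x,y)=(\mu\circ_1 x)\circ_{p+1}y$. A $(p,q)$-shuffle is $\sigma\in\Sigma_{p+q}$ with $\sigma(1)<\dots<\sigma(p)$ and $\sigma(p+1)<\dots<\sigma(p+q)$; $\mathrm{sgn}$ is the signature. A differential graded algebra here means an associative unital algebra whose differential $d^{\mathcal{O}}$ is square-zero and satisfies $d^{\mathcal{O}}(x\nabla y)=d^{\mathcal{O}}(x)\nabla y+(-1)^{|x|}x\nabla d^{\mathcal{O}}(y)$, $|x|$ being the internal degree. *)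

theory Defs
  imports Complex_Main "HOL-Combinatorics.Permutations"
begin

section \<open>Internal direct sums\<close>

text \<open>A decomposition of \<open>x\<close> is a finitely supported family of components \<open>f i\<close> in \<open>V i\<close> with sum \<open>x\<close>.\<close>

definition is_decomposition :: "('i \<Rightarrow> 'a::comm_monoid_add set) \<Rightarrow> 'a \<Rightarrow> ('i \<Rightarrow> 'a) \<Rightarrow> bool" where
  "is_decomposition V x f \<longleftrightarrow>
     finite {i. f i \<noteq> 0} \<and> (\<forall>i. f i \<in> V i) \<and> x = (\<Sum>i | f i \<noteq> 0. f i)"

definition components :: "('i \<Rightarrow> 'a::comm_monoid_add set) \<Rightarrow> 'a \<Rightarrow> 'i \<Rightarrow> 'a" where
  "components V x = (THE f. is_decomposition V x f)"

definition (in vector_space) internal_direct_sum :: "('i \<Rightarrow> 'b set) \<Rightarrow> bool" where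
  "internal_direct_sum V \<longleftrightarrow>
     (\<forall>i. subspace (V i)) \<and> (\<forall>x. \<exists>!f. is_decomposition V x f)"


section \<open>Symmetric dg operads\<close>

text \<open>
  Permutations in \<open>\<Sigma>\<^sub>n\<close> are functions on \<open>nat\<close> that permute \<open>{1..n}\<close> and fix everything else.
  In \<open>sub_perm n m i \<sigma> \<tau>\<close>, with \<open>\<sigma> \<in> \<Sigma>\<^sub>n\<close> and \<open>\<tau> \<in> \<Sigma>\<^sub>m\<close>, the block replacing the entry \<open>\<sigma> i\<close> occupies
  the positions \<open>i, \<dots>, i + m - 1\<close>; it is empty if \<open>m = 0\<close>, and then the entries larger than
  \<open>\<sigma> i\<close> are lowered by one.
\<close>

definition sub_perm ::
    "nat \<Rightarrow> nat \<Rightarrow> nat \<Rightarrow> (nat \<Rightarrow> nat) \<Rightarrow> (nat \<Rightarrow> nat) \<Rightarrow> nat \<Rightarrow> nat" where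
  "sub_perm n m i \<sigma> \<tau> k =
     (let shift = (\<lambda>e. if e > \<sigma> i then e + m - 1 else e) in
      if k \<notin> {1..n + m - 1} then k
      else if k < i then shift (\<sigma> k)
      else if k < i + m then \<sigma> i + \<tau> (k + 1 - i) - 1
      else shift (\<sigma> (k + 1 - m)))"

text \<open>
  The type \<open>'a\<close> is the total space, i.e. the direct sum over all \<open>n\<close> and \<open>r\<close> of the spaces \<open>Op n r\<close>,
  the part of arity \<open>n\<close> and internal degree \<open>r\<close>. Any family of vector spaces arises in this way.
  Since a non-zero element of some \<open>Op n r\<close> determines \<open>n\<close> and \<open>r\<close>, the structure maps need no
  arity or degree index. \<open>act x \<sigma>\<close> is the right action, and \<open>comp x i y\<close> is the partial composition of
  \<open>x\<close> with \<open>y\<close> at input \<open>i\<close>; their values outside the homogeneous elements, permutations and inputs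
  named in the axioms are irrelevant.
\<close>

locale sigma_dg_operad = vector_space scale
  for scale :: "'k::field \<Rightarrow> 'a::ab_group_add \<Rightarrow> 'a" (infixr \<open>*s\<close> 75) +
  fixes Op :: "nat \<Rightarrow> nat \<Rightarrow> 'a set"
    and d :: "'a \<Rightarrow> 'a"
    and act :: "'a \<Rightarrow> (nat \<Rightarrow> nat) \<Rightarrow> 'a"
    and comp :: "'a \<Rightarrow> nat \<Rightarrow> 'a \<Rightarrow> 'a"
    and unit :: "'a"
  assumes direct_sum: "internal_direct_sum (\<lambda>(n, r). Op n r)"
    \<comment> \<open>differential\<close>
    and d_linear: "Vector_Spaces.linear scale scale d"
    and d_degree: "x \<in> Op n (Suc r) \<Longrightarrow> d x \<in> Op n r"
    and d_degree_0: "x \<in> Op n 0 \<Longrightarrow> d x = 0"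
    and d_square: "d (d x) = 0"
    \<comment> \<open>right action of the symmetric groups\<close>
    and act_closed: "\<sigma> permutes {1..n} \<Longrightarrow> x \<in> Op n r \<Longrightarrow> act x \<sigma> \<in> Op n r"
    and act_add: "\<sigma> permutes {1..n} \<Longrightarrow> x \<in> Op n r \<Longrightarrow> y \<in> Op n r \<Longrightarrow>
          act (x + y) \<sigma> = act x \<sigma> + act y \<sigma>"
    and act_scale: "\<sigma> permutes {1..n} \<Longrightarrow> x \<in> Op n r \<Longrightarrow> act (c *s x) \<sigma> = c *s act x \<sigma>"
    and act_id: "x \<in> Op n r \<Longrightarrow> act x id = x"
    and act_act: "\<sigma> permutes {1..n} \<Longrightarrow> \<tau> permutes {1..n} \<Longrightarrow> x \<in> Op n r \<Longrightarrow>
          act (act x \<sigma>) \<tau> = act x (\<sigma> \<circ> \<tau>)"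
    and d_act: "\<sigma> permutes {1..n} \<Longrightarrow> x \<in> Op n r \<Longrightarrow> d (act x \<sigma>) = act (d x) \<sigma>"
    \<comment> \<open>partial compositions\<close>
    and comp_closed: "i \<in> {1..n} \<Longrightarrow> x \<in> Op n r \<Longrightarrow> y \<in> Op m l \<Longrightarrow>
          comp x i y \<in> Op (n + m - 1) (r + l)"
    and comp_add_left: "i \<in> {1..n} \<Longrightarrow> x \<in> Op n r \<Longrightarrow> x' \<in> Op n r \<Longrightarrow> y \<in> Op m l \<Longrightarrow>
          comp (x + x') i y = comp x i y + comp x' i y"
    and comp_scale_left: "i \<in> {1..n} \<Longrightarrow> x \<in> Op n r \<Longrightarrow> y \<in> Op m l \<Longrightarrow>
          comp (c *s x) i y = c *s comp x i y"
    and comp_add_right: "i \<in> {1..n} \<Longrightarrow> x \<in> Op n r \<Longrightarrow> y \<in> Op m l \<Longrightarrow> y' \<in> Op m l \<Longrightarrow>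
          comp x i (y + y') = comp x i y + comp x i y'"
    and comp_scale_right: "i \<in> {1..n} \<Longrightarrow> x \<in> Op n r \<Longrightarrow> y \<in> Op m l \<Longrightarrow>
          comp x i (c *s y) = c *s comp x i y"
    and d_comp: "i \<in> {1..n} \<Longrightarrow> x \<in> Op n r \<Longrightarrow> y \<in> Op m l \<Longrightarrow>
          d (comp x i y) = comp (d x) i y + (-1) ^ r *s comp x i (d y)"
    \<comment> \<open>unit\<close>
    and unit_closed: "unit \<in> Op 1 0"
    and d_unit: "d unit = 0"
    and unit_left: "x \<in> Op n r \<Longrightarrow> comp unit 1 x = x"
    and unit_right: "i \<in> {1..n} \<Longrightarrow> x \<in> Op n r \<Longrightarrow> comp x i unit = x"
    \<comment> \<open>sequential and parallel associativity\<close>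
    and assoc_seq: "i \<in> {1..n} \<Longrightarrow> j \<in> {1..m} \<Longrightarrow>
          x \<in> Op n r \<Longrightarrow> y \<in> Op m l \<Longrightarrow> z \<in> Op k t \<Longrightarrow>
          comp (comp x i y) (i + j - 1) z = comp x i (comp y j z)"
    and assoc_par: "i \<in> {1..n} \<Longrightarrow> j \<in> {1..n} \<Longrightarrow> i < j \<Longrightarrow>
          x \<in> Op n r \<Longrightarrow> y \<in> Op m l \<Longrightarrow> z \<in> Op k t \<Longrightarrow>
          comp (comp x i y) (j + m - 1) z = (-1) ^ (l * t) *s comp (comp x j z) i y"
    \<comment> \<open>equivariance\<close>
    and equivariant: "i \<in> {1..n} \<Longrightarrow> \<sigma> permutes {1..n} \<Longrightarrow> \<tau> permutes {1..m} \<Longrightarrow>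
          x \<in> Op n r \<Longrightarrow> y \<in> Op m l \<Longrightarrow>
          comp (act x \<sigma>) i (act y \<tau>) = act (comp x (\<sigma> i) y) (sub_perm n m i \<sigma> \<tau>)"

locale multiplicative_sigma_dg_operad = sigma_dg_operad +
  fixes mu :: "'b"
  assumes mu_closed: "mu \<in> Op 2 0"
    and mu_assoc: "comp mu 1 mu = comp mu 2 mu"
    and d_mu: "d mu = 0"

locale pointed_sigma_dg_operad = sigma_dg_operad +
  fixes eta :: "'a \<Rightarrow> 'b"
  assumes eta_linear: "Vector_Spaces.linear (*) scale eta"
    and eta_inj: "inj eta"
    and eta_closed: "eta c \<in> Op 0 0"
    and d_eta: "d (eta c) = 0"
begin

definition base_point :: "'b" where
  "base_point = eta 1"

definition codegeneracy :: "nat \<Rightarrow> 'b \<Rightarrow> 'b" where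
  "codegeneracy i x = comp x i base_point"

end

text \<open>
  The structure maps are linear, hence determined by their values on the generators \<open>gens n r\<close>,
  which form a basis of \<open>Op n r\<close>; no compatibility of the generators with the structure maps is
  required.
\<close>

locale free_cosimplicial_sigma_dg_operad =
    multiplicative_sigma_dg_operad scale Op d act comp unit mu +
    pointed_sigma_dg_operad scale Op d act comp unit eta
  for scale :: "'k::field \<Rightarrow> 'a::ab_group_add \<Rightarrow> 'a" (infixr \<open>*s\<close> 75)
    and Op d act comp unit mu eta +
  fixes gens :: "nat \<Rightarrow> nat \<Rightarrow> 'a set"
  assumes gens_independent: "independent (gens n r)"
    and gens_span: "span (gens n r) = Op n r"
    and mu_base_left: "comp mu 1 base_point = unit"
    and mu_base_right: "comp mu 2 base_point = unit"
begin

text \<open>Cofaces on arity \<open>n\<close>.\<close>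

definition coface :: "nat \<Rightarrow> nat \<Rightarrow> 'a \<Rightarrow> 'a" where
  "coface n i x =
     (if i = 0 then comp mu 2 x else if i \<le> n then comp x i mu else comp mu 1 x)"

end


section \<open>The shuffle product\<close>

definition shuffle_perms :: "nat \<Rightarrow> nat \<Rightarrow> (nat \<Rightarrow> nat) set" where
  "shuffle_perms p q =
     {\<sigma>. \<sigma> permutes {1..p + q} \<and> strict_mono_on {1..p} \<sigma> \<and> strict_mono_on {p + 1..p + q} \<sigma>}"

context multiplicative_sigma_dg_operad
begin

text \<open>The product of \<open>x\<close> of arity \<open>p\<close> with \<open>y\<close>.\<close>

definition odot :: "nat \<Rightarrow> 'b \<Rightarrow> 'b \<Rightarrow> 'b" where
  "odot p x y = comp (comp mu 1 x) (p + 1) y"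

definition shuffle_sum :: "nat \<Rightarrow> nat \<Rightarrow> 'b \<Rightarrow> 'b \<Rightarrow> 'b" where
  "shuffle_sum p q x y =
     (\<Sum>\<sigma>\<in>shuffle_perms p q. scale (of_int (sign \<sigma>)) (act (odot p x y) (inv \<sigma>)))"

text \<open>
  The shuffle product on the total space is the bilinear extension of \<open>shuffle_sum\<close>, see
  \<open>shuffle_product_homogeneous\<close> below.
\<close>

definition shuffle_product :: "'b \<Rightarrow> 'b \<Rightarrow> 'b" where
  "shuffle_product x y =
     (let X = components (\<lambda>(n, r). Op n r) x; Y = components (\<lambda>(n, r). Op n r) y in
      \<Sum>(p, u)\<in>{i. X i \<noteq> 0}. \<Sum>(q, v)\<in>{j. Y j \<noteq> 0}.
        shuffle_sum p q (X (p, u)) (Y (q, v)))"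

lemma components_homogeneous:
  assumes "x \<in> Op n r"
  shows "components (\<lambda>(n, r). Op n r) x = (\<lambda>i. if i = (n, r) then x else 0)"
proof -
  let ?f = "\<lambda>i. if i = (n, r) then x else 0"
  have sub: "subspace (Op m s)" for m s
    using direct_sum unfolding internal_direct_sum_def by (auto dest: spec[of _ "(m, s)"])
  have "{i. ?f i \<noteq> 0} = (if x = 0 then {} else {(n, r)})" by auto
  then have "is_decomposition (\<lambda>(n, r). Op n r) x ?f"
    using assms sub subspace_0 unfolding is_decomposition_def by auto
  then show ?thesis
    using direct_sum unfolding internal_direct_sum_def components_def
    by (metis (no_types, lifting) the1_equality)
qed

lemma shuffle_sum_closed:
  assumes "x \<in> Op p u" "y \<in> Op q v"
  shows "shuffle_sum p q x y \<in> Op (p + q) (u + v)"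
proof -
  have sub: "subspace (Op m s)" for m s
    using direct_sum unfolding internal_direct_sum_def by (auto dest: spec[of _ "(m, s)"])
  have "comp mu 1 x \<in> Op (2 + p - 1) (0 + u)"
    by (rule comp_closed[OF _ mu_closed assms(1)]) simp
  then have "odot p x y \<in> Op (p + q) (u + v)"
    using comp_closed[OF _ _ assms(2), of "p + 1" "Suc p" "comp mu 1 x" u]
    unfolding odot_def by simp
  then show ?thesis
    unfolding shuffle_sum_def shuffle_perms_def
    by (intro subspace_sum subspace_scale sub act_closed permutes_inv) auto
qed

lemma shuffle_sum_zero:
  assumes "x \<in> Op p u" "y \<in> Op q v" "x = 0 \<or> y = 0"
  shows "shuffle_sum p q x y = 0"
proof -
  have m: "comp mu 1 x \<in> Op (Suc p) u"
    using comp_closed[OF _ mu_closed assms(1), of 1] by simp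
  have "odot p x y = 0"
    using assms(3)
  proof
    assume "x = 0"
    then have "comp mu 1 x = 0"
      using comp_scale_right[OF _ mu_closed assms(1), of 1 0] by simp
    then show ?thesis
      using comp_scale_left[OF _ m assms(2), of "p + 1" 0] unfolding odot_def by simp
  next
    assume "y = 0"
    then show ?thesis
      using comp_scale_right[OF _ m assms(2), of "p + 1" 0] unfolding odot_def by simp
  qed
  moreover have "act 0 (inv \<sigma>) = 0" if "\<sigma> permutes {1..p}" for \<sigma> :: "nat \<Rightarrow> nat" and p
    using act_scale[OF permutes_inv[OF that], of 0 0 0]
      direct_sum subspace_0[of "Op p 0"]
    unfolding internal_direct_sum_def
    by (metis (no_types, lifting) act_scale case_prod_conv permutes_inv scale_zero_left that)
  ultimately show ?thesis
    unfolding shuffle_sum_def shuffle_perms_def by (auto intro!: sum.neutral)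
qed

lemma shuffle_product_homogeneous:
  assumes "x \<in> Op p u" "y \<in> Op q v"
  shows "shuffle_product x y =
    (\<Sum>\<sigma>\<in>shuffle_perms p q. scale (of_int (sign \<sigma>)) (act (odot p x y) (inv \<sigma>)))"
proof -
  have S: "{i. (if i = (n, r) then z else 0) \<noteq> 0} = (if z = 0 then {} else {(n, r)})"
    for n r :: nat and z :: 'b
    by auto
  have "shuffle_product x y = shuffle_sum p q x y"
    using shuffle_sum_zero[OF assms]
    unfolding shuffle_product_def components_homogeneous[OF assms(1)]
      components_homogeneous[OF assms(2)] Let_def S
    by auto
  then show ?thesis unfolding shuffle_sum_def .
qed

end


section \<open>Differential graded algebras\<close>

locale dg_algebra = vector_space scale
  for scale :: "'k::field \<Rightarrow> 'a::ab_group_add \<Rightarrow> 'a" (infixr \<open>*s\<close> 75) +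
  fixes A :: "nat \<Rightarrow> 'a set"
    and mult :: "'a \<Rightarrow> 'a \<Rightarrow> 'a"
    and e :: "'a"
    and d :: "'a \<Rightarrow> 'a"
  assumes grading: "internal_direct_sum A"
    and mult_linear_right: "Vector_Spaces.linear scale scale (\<lambda>y. mult x y)"
    and mult_linear_left: "Vector_Spaces.linear scale scale (\<lambda>x. mult x y)"
    and mult_assoc: "mult (mult x y) z = mult x (mult y z)"
    and mult_one_left: "mult e x = x"
    and mult_one_right: "mult x e = x"
    and one_degree: "e \<in> A 0"
    and mult_degree: "x \<in> A r \<Longrightarrow> y \<in> A s \<Longrightarrow> mult x y \<in> A (r + s)"
    and d_linear: "Vector_Spaces.linear scale scale d"
    and d_degree: "x \<in> A (Suc r) \<Longrightarrow> d x \<in> A r"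
    and d_degree_0: "x \<in> A 0 \<Longrightarrow> d x = 0"
    and d_square: "d (d x) = 0"
    and leibniz: "x \<in> A r \<Longrightarrow> d (mult x y) = mult (d x) y + (-1) ^ r *s mult x (d y)"

text \<open>The internal degree \<open>r\<close> part of the total space, all arities together.\<close>

definition (in sigma_dg_operad) degree_part :: "nat \<Rightarrow> 'a set" where
  "degree_part r = span (\<Union>n. Op n r)"

end

theory Submission
  imports Defs "HOL-Library.Infinite_Set"
begin

text \<open>
  The product \<open>odot\<close> is strictly associative and unital, it satisfies the Leibniz rule
  because \<open>\<mu>\<close> is a cycle of degree 0, and equivariance turns the action of \<open>\<tau>\<close> on one factor into the
  action of \<open>\<tau> \<times> id\<close> or \<open>id \<times> \<tau>\<close> on the product. Hence both bracketings of a triple shuffle product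
  are signed sums over composites of two shuffles. Every \<open>(p, q, r)\<close>-shuffle factors uniquely as a
  \<open>(p + q, r)\<close>-shuffle after a \<open>(p, q)\<close>-shuffle and as a \<open>(p, q + r)\<close>-shuffle after a shifted
  \<open>(q, r)\<close>-shuffle, so both sums run over the \<open>(p, q, r)\<close>-shuffles.
\<close>

section \<open>Factorisation of shuffles\<close>

text \<open>By strong induction, suppose everything below \<open>x\<close> is fixed and
  \<open>\<tau> y = x\<close>. If \<open>y < x\<close>, then \<open>y\<close> is fixed, a
  contradiction. If \<open>x < y\<close>, then \<open>\<tau> x < x\<close> is a fixed point below
  \<open>x\<close>, against injectivity.\<close>

lemma strict_mono_on_permutes_imp_id:
  fixes \<tau> :: "nat \<Rightarrow> nat"
  assumes "\<tau> permutes B" "strict_mono_on B \<tau>"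
  shows "\<tau> = id"
proof
  fix x
  show "\<tau> x = id x"
  proof (induction x rule: less_induct)
    case (less x)
    show ?case
    proof (cases "x \<in> B")
      case True
      obtain y where y: "y \<in> B" "\<tau> y = x"
        using True assms(1) by (metis permutes_image imageE)
      have "\<not> y < x" using less.IH[of y] y by auto
      moreover have "\<not> x < y"
      proof
        assume "x < y"
        then have "\<tau> x < x" using assms(2) True y by (auto dest: strict_mono_onD)
        with less.IH[of "\<tau> x"] show False
          using permutes_inj[OF assms(1)] by (metis id_apply injD less_irrefl)
      qed
      ultimately show ?thesis using y by simp
    qed (use assms(1) in \<open>simp add: permutes_not_in\<close>)
  qed
qed

lemma ex_permutes_strict_mono_on:
  fixes f :: "nat \<Rightarrow> nat"
  assumes "finite B" "inj_on f B"
  obtains \<tau> where "\<tau> permutes B" "strict_mono_on B (f \<circ> inv \<tau>)"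
proof -
  obtain g where g: "bij_betw g {..<card B} B" "strict_mono_on {..<card B} g"
    using ex_bij_betw_strict_mono_card[OF assms(1)] by blast
  obtain h where h: "bij_betw h {..<card (f ` B)} (f ` B)" "strict_mono_on {..<card (f ` B)} h"
    using ex_bij_betw_strict_mono_card[OF finite_imageI[OF assms(1)]] by blast
  have c: "card (f ` B) = card B" using assms(2) by (rule card_image)
  have f: "bij_betw f B (f ` B)" using assms(2) by (rule inj_on_imp_bij_betw)
  define \<pi> where "\<pi> = restrict_id (inv_into B f \<circ> h \<circ> inv_into {..<card B} g) B"
  have b: "bij_betw (inv_into B f \<circ> h \<circ> inv_into {..<card B} g) B B"
    using bij_betw_trans[OF bij_betw_inv_into[OF g(1)]
        bij_betw_trans[OF h(1)[unfolded c] bij_betw_inv_into[OF f]]]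
    by (simp add: comp_assoc)
  have p: "\<pi> permutes B" unfolding \<pi>_def by (rule permutes_restrict_id[OF b])
  have "strict_mono_on B (f \<circ> \<pi>)"
  proof (rule strict_mono_onI)
    fix a a' assume a: "a \<in> B" "a' \<in> B" "a < a'"
    obtain i where i: "i < card B" "a = g i" using a(1) g(1) by (auto simp: bij_betw_def)
    obtain j where j: "j < card B" "a' = g j" using a(2) g(1) by (auto simp: bij_betw_def)
    have "i < j"
      using a(3) i j g(2) by (metis lessThan_iff linorder_neqE_nat order_less_asym strict_mono_onD)
    then have "h i < h j" using strict_mono_onD[OF h(2)] c i j by simp
    \<comment> \<open>So \<open>f \<circ> \<pi>\<close> carries the k-th smallest element of
      \<open>B\<close> to the k-th smallest value of \<open>f\<close>.\<close>
    moreover have "f (\<pi> (g k)) = h k" if "k < card B" for k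
    proof -
      have "g k \<in> B" "h k \<in> f ` B" using that g(1) h(1) c by (auto simp: bij_betw_def)
      then show ?thesis
        using that g(1) unfolding \<pi>_def
        by (simp add: bij_betw_def f_inv_into_f)
    qed
    ultimately show "(f \<circ> \<pi>) a < (f \<circ> \<pi>) a'" using i j by simp
  qed
  then have "strict_mono_on B (f \<circ> inv (inv \<pi>))"
    using p by (simp add: permutes_inv_inv)
  then show thesis using that p permutes_inv by blast
qed

text \<open>As \<tau> maps \<open>A\<close> into \<open>B\<close>, where \<sigma> both preserves and
  reflects the order, monotonicity on blocks inside \<open>B\<close> is a condition on \<tau>
  alone.\<close>

lemma strict_mono_on_comp_permutes_iff:
  fixes \<sigma> :: "nat \<Rightarrow> nat"
  assumes "strict_mono_on B \<sigma>" "\<tau> permutes B" "A \<subseteq> B"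
  shows "strict_mono_on A (\<sigma> \<circ> \<tau>) \<longleftrightarrow> strict_mono_on A \<tau>"
proof -
  have "\<sigma> (\<tau> x) < \<sigma> (\<tau> y) \<longleftrightarrow> \<tau> x < \<tau> y" if "x \<in> A" "y \<in> A" for x y
    using assms that permutes_in_image[OF assms(2)]
    by (metis linorder_neqE_nat order_less_asym strict_mono_onD subsetD)
  then show ?thesis by (auto simp: strict_mono_on_def)
qed

lemma strict_mono_on_comp_permutes_disjoint:
  assumes "\<tau> permutes B" "A \<inter> B = {}"
  shows "strict_mono_on A (\<sigma> \<circ> \<tau>) \<longleftrightarrow> strict_mono_on A \<sigma>"
proof -
  have "\<tau> x = x" if "x \<in> A" for x
    using assms that by (auto intro: permutes_not_in)
  then show ?thesis by (auto simp: strict_mono_on_def)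
qed

text \<open>The permutations of \<open>S\<close> that increase on \<open>B\<close> represent the
  left cosets of the permutations of \<open>B\<close>, whence the unique factorisation. Conditions
  on blocks inside \<open>B\<close> concern only the factor \<tau>, those on blocks disjoint from
  \<open>B\<close> only \<sigma>. Both bracketings of a triple shuffle product are
  instances.\<close>

lemma bij_betw_comp_strict_mono_on:
  fixes S B :: "nat set"
  assumes "finite S" "B \<subseteq> S"
    and \<A>: "\<And>A. A \<in> \<A> \<Longrightarrow> A \<subseteq> B" and \<C>: "\<And>C. C \<in> \<C> \<Longrightarrow> C \<inter> B = {}"
  shows "bij_betw (\<lambda>(\<sigma>, \<tau>). \<sigma> \<circ> \<tau>)
    ({\<sigma>. \<sigma> permutes S \<and> strict_mono_on B \<sigma> \<and> (\<forall>C\<in>\<C>. strict_mono_on C \<sigma>)} \<times>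
     {\<tau>. \<tau> permutes B \<and> (\<forall>A\<in>\<A>. strict_mono_on A \<tau>)})
    {\<rho>. \<rho> permutes S \<and> (\<forall>A\<in>\<A> \<union> \<C>. strict_mono_on A \<rho>)}"
proof (rule bij_betw_imageI)
  show "inj_on (\<lambda>(\<sigma>, \<tau>). \<sigma> \<circ> \<tau>)
    ({\<sigma>. \<sigma> permutes S \<and> strict_mono_on B \<sigma> \<and> (\<forall>C\<in>\<C>. strict_mono_on C \<sigma>)} \<times>
     {\<tau>. \<tau> permutes B \<and> (\<forall>A\<in>\<A>. strict_mono_on A \<tau>)})"
  proof (rule inj_onI, clarify)
    fix \<sigma> \<sigma>' \<tau> \<tau>' :: "nat \<Rightarrow> nat"
    assume s: "strict_mono_on B \<sigma>" "strict_mono_on B \<sigma>'"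
      and t: "\<tau> permutes B" "\<tau>' permutes B" and eq: "\<sigma> \<circ> \<tau> = \<sigma>' \<circ> \<tau>'"
    \<comment> \<open>Two factorisations differ by this permutation of \<open>B\<close>. It turns
      out to be increasing on \<open>B\<close>, hence trivial.\<close>
    have p: "\<tau>' \<circ> inv \<tau> permutes B"
      using t by (intro permutes_compose permutes_inv)
    have "\<sigma> = \<sigma> \<circ> \<tau> \<circ> inv \<tau>"
      using permutes_inv_o[OF t(1)] by (simp add: comp_assoc)
    then have e: "\<sigma> = \<sigma>' \<circ> (\<tau>' \<circ> inv \<tau>)"
      unfolding eq by (simp add: comp_assoc)
    then have "strict_mono_on B (\<tau>' \<circ> inv \<tau>)"
      using s strict_mono_on_comp_permutes_iff[OF s(2) p order_refl] by simp
    then have id: "\<tau>' \<circ> inv \<tau> = id"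
      by (rule strict_mono_on_permutes_imp_id[OF p])
    then have "\<tau>' \<circ> (inv \<tau> \<circ> \<tau>) = \<tau>" unfolding comp_assoc[symmetric] by simp
    then show "\<sigma> = \<sigma>' \<and> \<tau> = \<tau>'"
      using e id permutes_inv_o[OF t(1)] by simp
  qed
next
  show "(\<lambda>(\<sigma>, \<tau>). \<sigma> \<circ> \<tau>) `
    ({\<sigma>. \<sigma> permutes S \<and> strict_mono_on B \<sigma> \<and> (\<forall>C\<in>\<C>. strict_mono_on C \<sigma>)} \<times>
     {\<tau>. \<tau> permutes B \<and> (\<forall>A\<in>\<A>. strict_mono_on A \<tau>)}) =
    {\<rho>. \<rho> permutes S \<and> (\<forall>A\<in>\<A> \<union> \<C>. strict_mono_on A \<rho>)}" (is "?f ` ?D = ?R")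
  proof (intro equalityI subsetI)
    fix \<rho> assume "\<rho> \<in> ?f ` ?D"
    then obtain \<sigma> \<tau> where \<rho>: "\<rho> = \<sigma> \<circ> \<tau>" and D: "(\<sigma>, \<tau>) \<in> ?D" by auto
    have "\<tau> permutes S" using D permutes_subset[OF _ assms(2)] by blast
    moreover have "strict_mono_on C (\<sigma> \<circ> \<tau>)" if "C \<in> \<C>" for C
      using that D strict_mono_on_comp_permutes_disjoint[of \<tau> B C \<sigma>] \<C>[OF that] by simp
    moreover have "strict_mono_on A (\<sigma> \<circ> \<tau>)" if "A \<in> \<A>" for A
      using that D strict_mono_on_comp_permutes_iff[of B \<sigma> \<tau> A] \<A>[OF that] by simp
    moreover have "\<sigma> \<circ> \<tau> permutes S"
      using D \<open>\<tau> permutes S\<close> by (simp add: permutes_compose)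
    ultimately show "\<rho> \<in> ?R" unfolding \<rho> by blast
  next
    fix \<rho> assume \<rho>: "\<rho> \<in> ?R"
    have "finite B" "inj_on \<rho> B"
      using assms \<rho> finite_subset permutes_inj[of \<rho> S] by (auto intro: inj_on_subset)
    \<comment> \<open>Sorting \<rho> on \<open>B\<close> yields the coset representative
      \<open>\<rho> \<circ> inv \<tau>\<close>.\<close>
    then obtain \<tau> where \<tau>: "\<tau> permutes B" "strict_mono_on B (\<rho> \<circ> inv \<tau>)"
      by (rule ex_permutes_strict_mono_on)
    have \<tau>': "\<tau> permutes S" using \<tau>(1) permutes_subset[OF _ assms(2)] by blast
    define \<sigma> where "\<sigma> = \<rho> \<circ> inv \<tau>"
    have e: "\<rho> = \<sigma> \<circ> \<tau>"
      unfolding \<sigma>_def using permutes_inv_o[OF \<tau>(1)] by (simp add: comp_assoc)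
    have "strict_mono_on A \<tau>" if "A \<in> \<A>" for A
      using that \<rho> strict_mono_on_comp_permutes_iff[OF \<tau>(2) \<tau>(1) \<A>[OF that]]
      unfolding \<sigma>_def[symmetric] e[symmetric] by simp
    moreover have "strict_mono_on C \<sigma>" if "C \<in> \<C>" for C
    proof -
      have "strict_mono_on C \<rho>" using that \<rho> by simp
      then show ?thesis
        unfolding \<sigma>_def
        by (rule strict_mono_on_comp_permutes_disjoint[THEN iffD2,
              OF permutes_inv[OF \<tau>(1)] \<C>[OF that]])
    qed
    moreover have "\<sigma> permutes S"
      unfolding \<sigma>_def using \<rho> \<tau>' by (auto intro: permutes_compose permutes_inv)
    ultimately have "(\<sigma>, \<tau>) \<in> ?D" using \<tau> unfolding \<sigma>_def by auto
    then show "\<rho> \<in> ?f ` ?D" using e by force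
  qed
qed

section \<open>Triple shuffles and shifted permutations\<close>

definition shuffle_perms3 :: "nat \<Rightarrow> nat \<Rightarrow> nat \<Rightarrow> (nat \<Rightarrow> nat) set" where
  "shuffle_perms3 p q r = {\<rho>. \<rho> permutes {1..p + q + r} \<and> strict_mono_on {1..p} \<rho> \<and>
     strict_mono_on {p + 1..p + q} \<rho> \<and> strict_mono_on {p + q + 1..p + q + r} \<rho>}"

text \<open>The block permutation \<open>id \<times> \<tau>\<close>, with the identity on the first
  \<open>p\<close> letters. Transport along a translation carries over signs, composites and
  inverses.\<close>

definition shift_perm :: "nat \<Rightarrow> nat \<Rightarrow> (nat \<Rightarrow> nat) \<Rightarrow> nat \<Rightarrow> nat" where
  "shift_perm p n = map_permutation {1..n} ((+) p)"

lemma shift_perm_apply: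
  assumes "k \<in> {1..n}"
  shows "shift_perm p n \<tau> (p + k) = p + \<tau> k"
  unfolding shift_perm_def by (rule map_permutation_apply) (use assms in auto)

lemma shift_perm_outside:
  assumes "k \<notin> {p + 1..p + n}"
  shows "shift_perm p n \<tau> k = k"
  using assms unfolding shift_perm_def map_permutation_def
  by (auto intro!: restrict_id_simps simp: Suc_le_eq)

lemma shift_perm_bij: "bij_betw ((+) p) {1..n} {p + 1..p + n}" for p :: nat
  by (auto simp: bij_betw_def)

lemma shift_perm_permutes:
  assumes "\<tau> permutes {1..n}"
  shows "shift_perm p n \<tau> permutes {p + 1..p + n}"
  unfolding shift_perm_def by (rule map_permutation_permutes[OF shift_perm_bij assms])

lemma sign_shift_perm:
  assumes "\<tau> permutes {1..n}"
  shows "sign (shift_perm p n \<tau>) = sign \<tau>"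
  unfolding shift_perm_def by (rule sign_map_permutation) (use assms in auto)

lemma inv_shift_perm:
  assumes "\<tau> permutes {1..n}"
  shows "inv (shift_perm p n \<tau>) = shift_perm p n (inv \<tau>)"
proof (rule inv_unique_comp)
  have "shift_perm p n (\<tau> \<circ> \<tau>') = shift_perm p n \<tau> \<circ> shift_perm p n \<tau>'"
    if "\<tau> permutes {1..n}" "\<tau>' permutes {1..n}" for \<tau> \<tau>'
    using that unfolding shift_perm_def by (intro map_permutation_compose') auto
  moreover have "shift_perm p n id = id"
    unfolding shift_perm_def by (simp add: map_permutation_id')
  ultimately show "shift_perm p n \<tau> \<circ> shift_perm p n (inv \<tau>) = id"
      "shift_perm p n (inv \<tau>) \<circ> shift_perm p n \<tau> = id"
    using assms permutes_inv[OF assms] by (metis permutes_inv_o)+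
qed

lemma strict_mono_on_shift_perm:
  assumes "1 \<le> a" "b \<le> n"
  shows "strict_mono_on {p + a..p + b} (shift_perm p n \<tau>) \<longleftrightarrow> strict_mono_on {a..b} \<tau>"
proof -
  \<comment> \<open>Bounded quantifiers allow the substitution of \<open>p + k\<close> for the
    variable in each of them separately.\<close>
  have mono_iff: "strict_mono_on A f \<longleftrightarrow> (\<forall>r\<in>A. \<forall>s\<in>A. r < s \<longrightarrow> f r < f s)"
    for A and f :: "nat \<Rightarrow> nat"
    unfolding strict_mono_on_def by blast
  have im: "{p + a..p + b} = (+) p ` {a..b}" by simp
  have "(\<forall>x\<in>{p + a..p + b}. P x) \<longleftrightarrow> (\<forall>k\<in>{a..b}. P (p + k))" for P
    unfolding im by (simp only: ball_simps)
  then have "strict_mono_on {p + a..p + b} (shift_perm p n \<tau>) \<longleftrightarrow>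
      (\<forall>r\<in>{a..b}. \<forall>s\<in>{a..b}. p + r < p + s \<longrightarrow>
        shift_perm p n \<tau> (p + r) < shift_perm p n \<tau> (p + s))"
    by (simp only: mono_iff)
  also have "\<dots> \<longleftrightarrow> (\<forall>r\<in>{a..b}. \<forall>s\<in>{a..b}. r < s \<longrightarrow> \<tau> r < \<tau> s)"
    using assms by (simp add: shift_perm_apply)
  finally show ?thesis by (simp only: mono_iff)
qed

text \<open>The general factorisation produces permutations of the block
  \<open>{p + 1..p + q + r}\<close>. This identifies them with ordinary shuffles, over which the
  inner product of \<open>y\<close> and \<open>z\<close> is summed.\<close>

lemma bij_betw_shift_shuffle_perms:
  "bij_betw (shift_perm p (q + r)) (shuffle_perms q r)
     {\<tau>. \<tau> permutes {p + 1..p + q + r} \<and>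
       (\<forall>A\<in>{{p + 1..p + q}, {p + q + 1..p + q + r}}. strict_mono_on A \<tau>)}"
proof -
  have mono: "strict_mono_on {p + 1..p + q} (shift_perm p (q + r) \<tau>) \<longleftrightarrow> strict_mono_on {1..q} \<tau>"
    "strict_mono_on {p + q + 1..p + q + r} (shift_perm p (q + r) \<tau>) \<longleftrightarrow>
       strict_mono_on {q + 1..q + r} \<tau>" for \<tau>
    using strict_mono_on_shift_perm[of 1 q "q + r" p \<tau>]
      strict_mono_on_shift_perm[of "q + 1" "q + r" "q + r" p \<tau>]
    by (simp_all add: add_ac)
  have inj: "inj_on (shift_perm p n) {\<tau>. \<tau> permutes {1..n}}" for n
  proof (rule inj_onI)
    fix \<tau> \<tau>' assume t: "\<tau> \<in> {\<tau>. \<tau> permutes {1..n}}" "\<tau>' \<in> {\<tau>. \<tau> permutes {1..n}}"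
      and e: "shift_perm p n \<tau> = shift_perm p n \<tau>'"
    have "\<tau> k = \<tau>' k" for k
      using t fun_cong[OF e, of "p + k"] shift_perm_apply[of k n p]
      by (cases "k \<in> {1..n}") (auto simp: permutes_not_in)
    then show "\<tau> = \<tau>'" by auto
  qed
  \<comment> \<open>Surjectivity: transport back along the inverse translation.\<close>
  have im: "\<exists>\<tau>. \<tau> permutes {1..n} \<and> \<rho> = shift_perm p n \<tau>" if "\<rho> permutes {p + 1..p + n}" for \<rho> n
  proof -
    let ?g = "inv_into {1..n} ((+) p)"
    have g: "bij_betw ?g {p + 1..p + n} {1..n}"
      by (rule bij_betw_inv_into[OF shift_perm_bij])
    have "map_permutation {p + 1..p + n} ?g \<rho> permutes {1..n}"
      by (rule map_permutation_permutes[OF g that])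
    moreover have "shift_perm p n (map_permutation {p + 1..p + n} ?g \<rho>) = \<rho>"
      unfolding shift_perm_def
      by (rule map_permutation_compose_inv[OF g that]) (auto intro!: f_inv_into_f)
    ultimately show ?thesis by metis
  qed
  show ?thesis
  proof (rule bij_betw_imageI)
    show "inj_on (shift_perm p (q + r)) (shuffle_perms q r)"
      by (rule inj_on_subset[OF inj]) (auto simp: shuffle_perms_def)
    show "shift_perm p (q + r) ` shuffle_perms q r = {\<tau>. \<tau> permutes {p + 1..p + q + r} \<and>
       (\<forall>A\<in>{{p + 1..p + q}, {p + q + 1..p + q + r}}. strict_mono_on A \<tau>)}"
    proof (intro equalityI subsetI)
      fix \<rho> assume \<rho>: "\<rho> \<in> {\<tau>. \<tau> permutes {p + 1..p + q + r} \<and>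
        (\<forall>A\<in>{{p + 1..p + q}, {p + q + 1..p + q + r}}. strict_mono_on A \<tau>)}"
      then obtain \<tau> where "\<tau> permutes {1..q + r}" "\<rho> = shift_perm p (q + r) \<tau>"
        using im[of \<rho> "q + r"] by (auto simp: add.assoc)
      then show "\<rho> \<in> shift_perm p (q + r) ` shuffle_perms q r"
        using \<rho> mono[of \<tau>] unfolding shuffle_perms_def by auto
    next
      fix \<rho> assume "\<rho> \<in> shift_perm p (q + r) ` shuffle_perms q r"
      then obtain \<tau> where "\<tau> \<in> shuffle_perms q r" "\<rho> = shift_perm p (q + r) \<tau>" by blast
      then show "\<rho> \<in> {\<tau>. \<tau> permutes {p + 1..p + q + r} \<and>
          (\<forall>A\<in>{{p + 1..p + q}, {p + q + 1..p + q + r}}. strict_mono_on A \<tau>)}"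
        using mono[of \<tau>] shift_perm_permutes[of \<tau> "q + r" p]
        unfolding shuffle_perms_def by (simp add: add.assoc)
    qed
  qed
qed

text \<open>The general factorisation with \<open>B\<close> the union of the first two blocks; the
  third block is the only one disjoint from it.\<close>

lemma bij_betw_shuffle_perms3_left:
  "bij_betw (\<lambda>(\<sigma>, \<tau>). \<sigma> \<circ> \<tau>) (shuffle_perms (p + q) r \<times> shuffle_perms p q) (shuffle_perms3 p q r)"
proof -
  have "bij_betw (\<lambda>(\<sigma>, \<tau>). \<sigma> \<circ> \<tau>)
    ({\<sigma>. \<sigma> permutes {1..p + q + r} \<and> strict_mono_on {1..p + q} \<sigma> \<and>
       (\<forall>C\<in>{{p + q + 1..p + q + r}}. strict_mono_on C \<sigma>)} \<times>
     {\<tau>. \<tau> permutes {1..p + q} \<and> (\<forall>A\<in>{{1..p}, {p + 1..p + q}}. strict_mono_on A \<tau>)})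
    {\<rho>. \<rho> permutes {1..p + q + r} \<and>
       (\<forall>A\<in>{{1..p}, {p + 1..p + q}} \<union> {{p + q + 1..p + q + r}}. strict_mono_on A \<rho>)}"
    by (rule bij_betw_comp_strict_mono_on) auto
  moreover have "{\<rho>. \<rho> permutes {1..p + q + r} \<and>
       (\<forall>A\<in>{{1..p}, {p + 1..p + q}} \<union> {{p + q + 1..p + q + r}}. strict_mono_on A \<rho>)} =
       shuffle_perms3 p q r"
    unfolding shuffle_perms3_def by auto
  ultimately show ?thesis
    unfolding shuffle_perms_def by simp
qed

text \<open>Here \<open>B\<close> is the union of the last two blocks and the first block is
  disjoint from it. The factor permuting \<open>B\<close> is then rewritten as a shifted
  shuffle.\<close>

lemma bij_betw_shuffle_perms3_right:
  "bij_betw (\<lambda>(\<sigma>, \<tau>). \<sigma> \<circ> shift_perm p (q + r) \<tau>)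
     (shuffle_perms p (q + r) \<times> shuffle_perms q r) (shuffle_perms3 p q r)"
proof -
  let ?B = "{\<tau>. \<tau> permutes {p + 1..p + q + r} \<and>
      (\<forall>A\<in>{{p + 1..p + q}, {p + q + 1..p + q + r}}. strict_mono_on A \<tau>)}"
  have "bij_betw (\<lambda>(\<sigma>, \<tau>). \<sigma> \<circ> \<tau>)
    ({\<sigma>. \<sigma> permutes {1..p + q + r} \<and> strict_mono_on {p + 1..p + q + r} \<sigma> \<and>
       (\<forall>C\<in>{{1..p}}. strict_mono_on C \<sigma>)} \<times> ?B)
    {\<rho>. \<rho> permutes {1..p + q + r} \<and>
       (\<forall>A\<in>{{p + 1..p + q}, {p + q + 1..p + q + r}} \<union> {{1..p}}. strict_mono_on A \<rho>)}"
    by (rule bij_betw_comp_strict_mono_on) auto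
  moreover have "{\<sigma>. \<sigma> permutes {1..p + q + r} \<and> strict_mono_on {p + 1..p + q + r} \<sigma> \<and>
       (\<forall>C\<in>{{1..p}}. strict_mono_on C \<sigma>)} = shuffle_perms p (q + r)"
    unfolding shuffle_perms_def by (auto simp: add.assoc)
  moreover have "{\<rho>. \<rho> permutes {1..p + q + r} \<and>
       (\<forall>A\<in>{{p + 1..p + q}, {p + q + 1..p + q + r}} \<union> {{1..p}}. strict_mono_on A \<rho>)} =
       shuffle_perms3 p q r"
    unfolding shuffle_perms3_def by auto
  ultimately have "bij_betw (\<lambda>(\<sigma>, \<tau>). \<sigma> \<circ> \<tau>) (shuffle_perms p (q + r) \<times> ?B) (shuffle_perms3 p q r)"
    by simp
  moreover have "bij_betw (map_prod id (shift_perm p (q + r)))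
      (shuffle_perms p (q + r) \<times> shuffle_perms q r) (shuffle_perms p (q + r) \<times> ?B)"
    by (rule bij_betw_map_prod[OF bij_betw_id bij_betw_shift_shuffle_perms])
  ultimately have "bij_betw ((\<lambda>(\<sigma>, \<tau>). \<sigma> \<circ> \<tau>) \<circ> map_prod id (shift_perm p (q + r)))
      (shuffle_perms p (q + r) \<times> shuffle_perms q r) (shuffle_perms3 p q r)"
    using bij_betw_trans by blast
  then show ?thesis by (simp add: comp_def case_prod_beta' map_prod_def)
qed

text \<open>With one block empty, a shuffle increases on its whole support and is trivial. This is
  the combinatorial half of the unit laws.\<close>

lemma shuffle_perms_0: "shuffle_perms 0 q = {id}" "shuffle_perms p 0 = {id}"
  unfolding shuffle_perms_def
  using strict_mono_on_permutes_imp_id[of _ "{1..q}"] strict_mono_on_permutes_imp_id[of _ "{1..p}"]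
  by (auto simp: strict_mono_on_def permutes_id)

section \<open>Block permutations arising from equivariance\<close>

lemma sub_perm_id_left:
  assumes "\<tau> permutes {1..m}" "p < n"
  shows "sub_perm n m (Suc p) id \<tau> = shift_perm p m \<tau>"
proof
  fix k
  show "sub_perm n m (Suc p) id \<tau> k = shift_perm p m \<tau> k"
  proof (cases "k \<in> {p + 1..p + m}")
    case True
    then obtain j where j: "j \<in> {1..m}" "k = p + j"
      by (metis shift_perm_bij bij_betw_imp_surj_on imageE)
    then have "shift_perm p m \<tau> k = p + \<tau> j" by (simp add: shift_perm_apply)
    \<comment> \<open>The bound \<open>p < n\<close> keeps the block inside the range outside which
      \<open>sub_perm\<close> is the identity.\<close>
    moreover have "p + j \<le> n + m - 1" using j assms(2) by auto
    ultimately show ?thesis using j by (simp add: sub_perm_def)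
  next
    case False
    then have "shift_perm p m \<tau> k = k" by (rule shift_perm_outside)
    then show ?thesis using False assms(2) by (auto simp: sub_perm_def Let_def)
  qed
qed

lemma shift_perm_0:
  assumes "\<tau> permutes {1..n}"
  shows "shift_perm 0 n \<tau> = \<tau>"
proof
  show "shift_perm 0 n \<tau> k = \<tau> k" for k
    using shift_perm_apply[of k n 0 \<tau>] shift_perm_outside[of k 0 n \<tau>] assms
    by (cases "k \<in> {1..n}") (auto simp: permutes_not_in)
qed

text \<open>The entry replaced is the last one and the largest, so no other entry is raised or
  lowered. Since permutations fix all numbers outside their range,
  \<open>\<sigma> \<times> id\<close> is \<sigma> itself as a function.\<close>

lemma sub_perm_last_id:
  assumes "\<sigma> permutes {1..p}"
  shows "sub_perm (Suc p) m (Suc p) \<sigma> id = \<sigma>"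
proof
  fix k
  have "\<sigma> (Suc p) = Suc p" using assms by (simp add: permutes_not_in)
  moreover have "\<sigma> k \<le> p" if "k \<in> {1..p}"
    using permutes_in_image[OF assms, of k] that by simp
  moreover have "\<sigma> k = k" if "k \<notin> {1..p}" using permutes_not_in[OF assms that] .
  ultimately show "sub_perm (Suc p) m (Suc p) \<sigma> id k = \<sigma> k"
    by (cases "k \<in> {1..p}") (auto simp: sub_perm_def Let_def)
qed

section \<open>Internal direct sums\<close>

context vector_space
begin

text \<open>The operad axioms give additivity of \<open>act\<close> and \<open>comp\<close> only on
  a single summand \<open>Op n r\<close>, so linearity has to be used relative to a subspace. This
  moves the signed sum of an inner shuffle product out of \<open>odot\<close> and
  \<open>act\<close>.\<close>

lemma hom_on_subspace_sum:
  assumes V: "subspace V"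
    and add: "\<And>x y. x \<in> V \<Longrightarrow> y \<in> V \<Longrightarrow> f (x + y) = f x + f y"
    and scal: "\<And>c x. x \<in> V \<Longrightarrow> f (scale c x) = scale c (f x)"
    and g: "\<And>i. i \<in> I \<Longrightarrow> g i \<in> V"
  shows "f (\<Sum>i\<in>I. scale (c i) (g i)) = (\<Sum>i\<in>I. scale (c i) (f (g i)))"
proof -
  have f0: "f 0 = 0" using scal[OF subspace_0[OF V], of 0] by simp
  show ?thesis
    using g
  proof (induction I rule: infinite_finite_induct)
    case (insert i I)
    then have "(\<Sum>i\<in>I. scale (c i) (g i)) \<in> V" "scale (c i) (g i) \<in> V"
      by (auto intro!: subspace_sum subspace_scale V)
    with insert show ?case by (simp add: add scal)
  qed (simp_all add: f0)
qed

context
  fixes V :: "'i \<Rightarrow> 'b set"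
  assumes V: "internal_direct_sum V"
begin

lemma subspace_summand: "subspace (V i)"
  using V unfolding internal_direct_sum_def by blast

lemma is_decomposition_components: "is_decomposition V x (components V x)"
  using V unfolding internal_direct_sum_def components_def by (metis theI')

lemma components_unique: "is_decomposition V x f \<Longrightarrow> components V x = f"
  using V is_decomposition_components[of x] unfolding internal_direct_sum_def by metis

lemma components_in: "components V x i \<in> V i"
  using is_decomposition_components unfolding is_decomposition_def by blast

lemma finite_components: "finite {i. components V x i \<noteq> 0}"
  using is_decomposition_components unfolding is_decomposition_def by blast

lemma sum_components:
  assumes "finite I" "{i. components V x i \<noteq> 0} \<subseteq> I"
  shows "(\<Sum>i\<in>I. components V x i) = x"
proof -
  have "(\<Sum>i\<in>I. components V x i) = (\<Sum>i | components V x i \<noteq> 0. components V x i)"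
    by (rule sum.mono_neutral_right[OF assms]) auto
  then show ?thesis
    using is_decomposition_components[of x] unfolding is_decomposition_def by simp
qed

text \<open>The finite set \<open>I\<close> may exceed the support of \<open>f\<close>. For a sum of
  two vectors one can thus take the union of the supports, even if terms cancel.\<close>

lemma components_eqI:
  assumes "finite I" "\<And>i. f i \<in> V i" "\<And>i. i \<notin> I \<Longrightarrow> f i = 0" "(\<Sum>i\<in>I. f i) = x"
  shows "components V x = f"
proof (rule components_unique)
  have I: "{i. f i \<noteq> 0} \<subseteq> I" using assms(3) by blast
  then have "finite {i. f i \<noteq> 0}" using assms(1) by (rule finite_subset)
  moreover have "(\<Sum>i | f i \<noteq> 0. f i) = x"
    unfolding assms(4)[symmetric] by (rule sum.mono_neutral_left[OF assms(1) I]) simp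
  ultimately show "is_decomposition V x f"
    using assms(2) unfolding is_decomposition_def by simp
qed

lemma components_add: "components V (x + y) = (\<lambda>i. components V x i + components V y i)"
proof (rule components_eqI)
  let ?I = "{i. components V x i \<noteq> 0} \<union> {i. components V y i \<noteq> 0}"
  show "finite ?I" by (simp add: finite_components)
  then show "(\<Sum>i\<in>?I. components V x i + components V y i) = x + y"
    by (simp add: sum.distrib sum_components)
qed (auto intro: subspace_add subspace_summand components_in)

lemma components_scale: "components V (scale c x) = (\<lambda>i. scale c (components V x i))"
proof (rule components_eqI)
  let ?I = "{i. components V x i \<noteq> 0}"
  show "finite ?I" by (simp add: finite_components)
  then show "(\<Sum>i\<in>?I. scale c (components V x i)) = scale c x"
    by (simp add: scale_sum_right[symmetric] sum_components)
qed (auto intro: subspace_scale subspace_summand components_in)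

lemma components_zero: "components V 0 = (\<lambda>i. 0)"
  using components_scale[of 0 0] by simp

lemma components_sum: "components V (\<Sum>a\<in>A. f a) i = (\<Sum>a\<in>A. components V (f a) i)"
  by (induction A rule: infinite_finite_induct) (auto simp: components_zero components_add)

lemma components_summand:
  assumes "x \<in> V i"
  shows "components V x = (\<lambda>j. if j = i then x else 0)"
  by (rule components_eqI[of "{i}"]) (use assms subspace_0[OF subspace_summand] in auto)

lemma span_summands: "span (\<Union>i. V i) = UNIV"
proof -
  have "(\<Sum>i | components V x i \<noteq> 0. components V x i) \<in> span (\<Union>i. V i)" for x
    by (rule span_sum, rule span_base) (auto intro: components_in)
  then have "x \<in> span (\<Union>i. V i)" for x
    by (simp only: sum_components[OF finite_components order_refl])
  then show ?thesis by blast
qed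

text \<open>Grouping components along the fibres of \<open>h\<close> gives existence; uniqueness
  holds because the fine components of each coarse part are forced. With \<open>h = snd\<close> this
  forgets the arity and leaves the internal degree.\<close>

lemma internal_direct_sum_coarsen:
  fixes h :: "'i \<Rightarrow> 'r"
  shows "internal_direct_sum (\<lambda>r. span (\<Union>i\<in>h -` {r}. V i))" (is "internal_direct_sum ?W")
proof -
  \<comment> \<open>Vanishing of a fixed component is a linear condition, so it need only be checked
    on the summands over \<open>r\<close>.\<close>
  have W0: "components V x i = 0" if "x \<in> ?W r" "h i \<noteq> r" for x r i
    using that(1)
  proof (induction rule: span_induct)
    case base
    show ?case by (rule subspaceI) (simp_all add: components_zero components_add components_scale)
  next
    case (step x)
    then obtain j where "h j = r" "x \<in> V j" by auto
    then show ?case using that(2) components_summand[of x j] by auto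
  qed
  have ex: "\<exists>f. is_decomposition ?W x f" for x
  proof -
    let ?S = "{i. components V x i \<noteq> 0}"
    define f where "f r = (\<Sum>i\<in>{i\<in>?S. h i = r}. components V x i)" for r
    have sub: "{r. f r \<noteq> 0} \<subseteq> h ` ?S"
    proof
      fix r assume "r \<in> {r. f r \<noteq> 0}"
      then have "{i\<in>?S. h i = r} \<noteq> {}" unfolding f_def mem_Collect_eq by (metis sum.empty)
      then show "r \<in> h ` ?S" by blast
    qed
    have fin: "finite (h ` ?S)" using finite_components by blast
    have "(\<Sum>r | f r \<noteq> 0. f r) = (\<Sum>r\<in>h ` ?S. f r)"
      by (rule sum.mono_neutral_left[OF fin sub]) auto
    also have "\<dots> = (\<Sum>i\<in>?S. components V x i)"
      unfolding f_def by (rule sum.image_gen[symmetric, OF finite_components])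
    also have "\<dots> = x" by (rule sum_components[OF finite_components order_refl])
    finally have "(\<Sum>r | f r \<noteq> 0. f r) = x" .
    moreover have "f r \<in> ?W r" for r
      unfolding f_def by (rule span_sum, rule span_base) (auto intro: components_in)
    moreover have "finite {r. f r \<noteq> 0}" using sub fin by (rule finite_subset)
    ultimately have "is_decomposition ?W x f"
      unfolding is_decomposition_def by simp
    then show ?thesis by blast
  qed
  \<comment> \<open>The right-hand side does not mention \<open>f\<close>, so any two coarse
    decompositions of \<open>x\<close> agree.\<close>
  have comp: "components V (f r) i = (if h i = r then components V x i else 0)"
    if f: "is_decomposition ?W x f" for x f r i
  proof (cases "h i = r")
    case True
    have fin: "finite {s. f s \<noteq> 0}" and x: "x = (\<Sum>s | f s \<noteq> 0. f s)"
      using f unfolding is_decomposition_def by blast+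
    have "components V x i = (\<Sum>s | f s \<noteq> 0. components V (f s) i)"
      by (subst x) (rule components_sum)
    also have "\<dots> = (\<Sum>s | f s \<noteq> 0. if s = r then components V (f r) i else 0)"
    proof (rule sum.cong[OF refl])
      fix s
      have "f s \<in> ?W s" using f unfolding is_decomposition_def by blast
      then show "components V (f s) i = (if s = r then components V (f r) i else 0)"
        using True W0[of "f s" s i] by (cases "s = r") auto
    qed
    also have "\<dots> = components V (f r) i"
      using fin by (simp add: components_zero)
    finally show ?thesis using True by simp
  next
    case False
    have "f r \<in> ?W r" using f unfolding is_decomposition_def by blast
    then show ?thesis using False W0[of "f r" r i] by simp
  qed
  have "f = g" if "is_decomposition ?W x f" "is_decomposition ?W x g" for x f g
  proof
    fix r
    have "components V (f r) = components V (g r)"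
      using comp[OF that(1)] comp[OF that(2)] by auto
    then show "f r = g r"
      by (metis sum_components[OF finite_components order_refl])
  qed
  with ex have "\<exists>!f. is_decomposition ?W x f" for x by metis
  then show ?thesis
    unfolding internal_direct_sum_def using subspace_span by blast
qed

end

end

section \<open>The shuffle algebra of an operad\<close>

context sigma_dg_operad
begin

lemma subspace_Op: "subspace (Op n r)"
  using subspace_summand[OF direct_sum, of "(n, r)"] by simp

lemma zero_in_Op [simp]: "0 \<in> Op n r"
  by (rule subspace_0[OF subspace_Op])

lemma comp_zero_left: "i \<in> {1..n} \<Longrightarrow> y \<in> Op m l \<Longrightarrow> comp 0 i y = 0"
  using comp_scale_left[of i n 0 0 y m l 0] by simp

text \<open>For \<open>r = 0\<close> the truncated difference is 0 again, which is harmless because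
  \<open>d x = 0\<close> there.\<close>

lemma d_closed: "x \<in> Op n r \<Longrightarrow> d x \<in> Op n (r - 1)"
  using d_degree d_degree_0 by (cases r) auto

lemma d_add: "d (x + y) = d x + d y"
  and d_scale: "d (c *s x) = c *s d x"
  using d_linear by (simp_all add: Vector_Spaces.linear_iff)

lemma d_zero: "d 0 = 0"
  using d_scale[of 0 0] by simp

lemma d_sum: "d (\<Sum>i\<in>I. f i) = (\<Sum>i\<in>I. d (f i))"
  by (induction I rule: infinite_finite_induct) (simp_all add: d_zero d_add)

text \<open>The summands span the total space. Multilinear identities are reduced to homogeneous
  elements in this way, one argument at a time.\<close>

lemma homogeneous_induct:
  assumes "subspace (Collect P)" "\<And>n r x. x \<in> Op n r \<Longrightarrow> P x"
  shows "P x"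
proof -
  have "x \<in> span (\<Union>i. case i of (n, r) \<Rightarrow> Op n r)"
    using span_summands[OF direct_sum] by simp
  then show ?thesis
    by (rule span_induct) (use assms in auto)
qed

lemma degree_part_eq: "degree_part r = span (\<Union>(n, s)\<in>snd -` {r}. Op n s)"
proof -
  have "(\<Union>(n, s)\<in>snd -` {r}. Op n s) = (\<Union>n. Op n r)" by (auto simp: vimage_def)
  then show ?thesis unfolding degree_part_def by simp
qed

lemma internal_direct_sum_degree_part: "internal_direct_sum degree_part"
  using internal_direct_sum_coarsen[OF direct_sum, of snd]
  unfolding degree_part_eq[abs_def] .

lemma Op_subset_degree_part: "x \<in> Op n r \<Longrightarrow> x \<in> degree_part r"
  unfolding degree_part_def by (rule span_base) blast

lemma subspace_degree_part: "subspace (degree_part r)"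
  unfolding degree_part_def by (rule subspace_span)

lemma degree_part_induct [consumes 1]:
  assumes "x \<in> degree_part r" "subspace (Collect P)" "\<And>n x. x \<in> Op n r \<Longrightarrow> P x"
  shows "P x"
  using assms(1) unfolding degree_part_def
  by (rule span_induct) (use assms in auto)

end

section \<open>The product \<open>odot\<close> on homogeneous elements\<close>

context multiplicative_sigma_dg_operad
begin

lemma mu_comp_closed:
  assumes "x \<in> Op p u"
  shows "comp mu 1 x \<in> Op (Suc p) u"
  using comp_closed[OF _ mu_closed assms, of 1] by simp

lemma odot_closed:
  assumes "x \<in> Op p u" "y \<in> Op q v"
  shows "odot p x y \<in> Op (p + q) (u + v)"
  using comp_closed[OF _ mu_comp_closed[OF assms(1)] assms(2), of "p + 1"]
  unfolding odot_def by simp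

lemma odot_add_left:
  assumes "x \<in> Op p u" "x' \<in> Op p u" "y \<in> Op q v"
  shows "odot p (x + x') y = odot p x y + odot p x' y"
  unfolding odot_def
  using comp_add_right[OF _ mu_closed assms(1,2), of 1] assms(3)
    comp_add_left[OF _ mu_comp_closed[OF assms(1)] mu_comp_closed[OF assms(2)] assms(3),
      of "p + 1"]
  by simp

lemma odot_scale_left:
  assumes "x \<in> Op p u" "y \<in> Op q v"
  shows "odot p (scale c x) y = scale c (odot p x y)"
  unfolding odot_def
  using comp_scale_right[OF _ mu_closed assms(1), of 1]
    comp_scale_left[OF _ mu_comp_closed[OF assms(1)] assms(2), of "p + 1"]
  by simp

lemma odot_add_right:
  assumes "x \<in> Op p u" "y \<in> Op q v" "y' \<in> Op q v"
  shows "odot p x (y + y') = odot p x y + odot p x y'"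
  unfolding odot_def
  by (rule comp_add_right[OF _ mu_comp_closed[OF assms(1)] assms(2,3)]) simp

lemma odot_scale_right:
  assumes "x \<in> Op p u" "y \<in> Op q v"
  shows "odot p x (scale c y) = scale c (odot p x y)"
  unfolding odot_def
  by (rule comp_scale_right[OF _ mu_comp_closed[OF assms(1)] assms(2)]) simp

lemma odot_zero:
  assumes "x \<in> Op p u"
  shows "odot q 0 x = 0" "odot p x 0 = 0"
  using odot_scale_left[OF zero_in_Op assms, where p = q and c = 0]
    odot_scale_right[OF assms zero_in_Op, where c = 0]
  by simp_all

text \<open>Both sides become \<open>comp (comp mu 1 x) (p + 1) (comp mu 1 y)\<close> with
  \<open>z\<close> inserted at input \<open>p + q + 1\<close>. On the left this takes
  \<open>mu_assoc\<close>, on the right only sequential associativity.\<close>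

lemma odot_assoc:
  assumes x: "x \<in> Op p u" and y: "y \<in> Op q v" and z: "z \<in> Op r w"
  shows "odot (p + q) (odot p x y) z = odot p x (odot q y z)"
proof -
  note mx = mu_comp_closed[OF x] and my = mu_comp_closed[OF y]
  have "comp mu 1 (odot p x y) = comp (comp mu 1 (comp mu 1 x)) (p + 1) y"
    unfolding odot_def using assoc_seq[OF _ _ mu_closed mx y, of 1 "p + 1"] by simp
  also have "comp mu 1 (comp mu 1 x) = comp (comp mu 1 mu) 1 x"
    using assoc_seq[OF _ _ mu_closed mu_closed x, of 1 1] by simp
  also have "\<dots> = comp (comp mu 2 mu) 1 x" by (simp only: mu_assoc)
  \<comment> \<open>Parallel associativity at inputs 1 and 2 of the outer \<open>mu\<close>; the
    Koszul sign is trivial as the inner \<open>mu\<close> has degree 0.\<close>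
  also have "\<dots> = comp (comp mu 1 x) (p + 1) mu"
    using assoc_par[OF _ _ _ mu_closed x mu_closed, of 1 2] by simp
  also have "comp (comp (comp mu 1 x) (p + 1) mu) (p + 1) y =
      comp (comp mu 1 x) (p + 1) (comp mu 1 y)"
    using assoc_seq[OF _ _ mx mu_closed y, of "p + 1" 1] by simp
  finally have *: "comp mu 1 (odot p x y) = comp (comp mu 1 x) (p + 1) (comp mu 1 y)" .
  have "odot (p + q) (odot p x y) z =
      comp (comp (comp mu 1 x) (p + 1) (comp mu 1 y)) (p + q + 1) z"
    unfolding odot_def[of "p + q"] * by (rule refl)
  also have "\<dots> = comp (comp mu 1 x) (p + 1) (comp (comp mu 1 y) (q + 1) z)"
    using assoc_seq[OF _ _ mx my z, of "p + 1" "q + 1"] by simp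
  finally show ?thesis by (simp add: odot_def[of p] odot_def[of q])
qed

text \<open>Equivariance is applied to both compositions, with \<open>id\<close> acting on
  \<open>mu\<close> and on \<open>y\<close>. The resulting \<open>\<tau> \<times> id\<close> is the
  function \<tau>, and \<tau> fixes the input \<open>p + 1\<close> where \<open>y\<close> is
  inserted.\<close>

lemma odot_act_left:
  assumes x: "x \<in> Op p u" and y: "y \<in> Op q v" and \<tau>: "\<tau> permutes {1..p}"
  shows "odot p (act x \<tau>) y = act (odot p x y) \<tau>"
proof -
  have \<tau>': "\<tau> permutes {1..Suc p}" using \<tau> by (rule permutes_subset) simp
  have "comp mu 1 (act x \<tau>) = comp (act mu id) 1 (act x \<tau>)"
    using act_id[OF mu_closed] by simp
  also have "\<dots> = act (comp mu 1 x) \<tau>"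
    using equivariant[OF _ permutes_id \<tau> mu_closed x, of 1]
      sub_perm_id_left[OF \<tau>, of 0 2] shift_perm_0[OF \<tau>] by simp
  finally have "odot p (act x \<tau>) y = comp (act (comp mu 1 x) \<tau>) (p + 1) (act y id)"
    unfolding odot_def using act_id[OF y] by simp
  also have "\<dots> = act (comp (comp mu 1 x) (\<tau> (p + 1)) y) \<tau>"
    using equivariant[OF _ \<tau>' permutes_id mu_comp_closed[OF x] y, of "p + 1"]
      sub_perm_last_id[OF \<tau>] by simp
  also have "\<tau> (p + 1) = p + 1" using \<tau> by (simp add: permutes_not_in)
  finally show ?thesis unfolding odot_def .
qed

lemma odot_act_right:
  assumes x: "x \<in> Op p u" and y: "y \<in> Op q v" and \<tau>: "\<tau> permutes {1..q}"
  shows "odot p x (act y \<tau>) = act (odot p x y) (shift_perm p q \<tau>)"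
proof -
  note mx = mu_comp_closed[OF x]
  have "odot p x (act y \<tau>) = comp (act (comp mu 1 x) id) (p + 1) (act y \<tau>)"
    unfolding odot_def using act_id[OF mx] by simp
  also have "\<dots> = act (comp (comp mu 1 x) (p + 1) y) (shift_perm p q \<tau>)"
    using equivariant[OF _ permutes_id \<tau> mx y, of "p + 1"]
      sub_perm_id_left[OF \<tau>, of p "Suc p"] by simp
  finally show ?thesis unfolding odot_def .
qed

text \<open>Since \<open>mu\<close> is a cycle of degree 0, only \<open>x\<close> contributes a
  sign, through the degree \<open>u\<close> of \<open>comp mu 1 x\<close>.\<close>

lemma d_odot:
  assumes x: "x \<in> Op p u" and y: "y \<in> Op q v"
  shows "d (odot p x y) = odot p (d x) y + scale ((-1) ^ u) (odot p x (d y))"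
proof -
  have "d (comp mu 1 x) = comp mu 1 (d x)"
    using d_comp[OF _ mu_closed x, of 1] comp_zero_left[OF _ x, of 1 2] by (simp add: d_mu)
  then show ?thesis
    unfolding odot_def using d_comp[OF _ mu_comp_closed[OF x] y, of "p + 1"] by simp
qed

section \<open>Linearity and the Leibniz rule for shuffle sums\<close>

lemma act_linear_combination:
  assumes "\<sigma> permutes {1..n}" "w \<in> Op n k" "w' \<in> Op n k"
  shows "act (scale a w + scale b w') \<sigma> = scale a (act w \<sigma>) + scale b (act w' \<sigma>)"
  using act_add[OF assms(1) subspace_scale[OF subspace_Op assms(2)]
      subspace_scale[OF subspace_Op assms(3)]]
    act_scale[OF assms(1,2)] act_scale[OF assms(1,3)] by simp

lemma shuffle_permsD: "\<sigma> \<in> shuffle_perms p q \<Longrightarrow> \<sigma> permutes {1..p + q}"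
  unfolding shuffle_perms_def by blast

lemma permutes_inv_shuffle: "\<sigma> \<in> shuffle_perms p q \<Longrightarrow> inv \<sigma> permutes {1..p + q}"
  using shuffle_permsD permutes_inv by blast

text \<open>A common source for additivity and homogeneity in either argument: coefficients 1 and 1
  give the former, \<open>c\<close> and 0 the latter.\<close>

lemma shuffle_sum_linear_combination:
  assumes w: "odot p x y = scale a (odot p x' y') + scale b (odot p x'' y'')"
    and "odot p x' y' \<in> Op (p + q) u" "odot p x'' y'' \<in> Op (p + q) u"
  shows "shuffle_sum p q x y = scale a (shuffle_sum p q x' y') + scale b (shuffle_sum p q x'' y'')"
proof -
  have "act (odot p x y) (inv \<sigma>) =
      scale a (act (odot p x' y') (inv \<sigma>)) + scale b (act (odot p x'' y'') (inv \<sigma>))"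
    if "\<sigma> \<in> shuffle_perms p q" for \<sigma>
    unfolding w by (rule act_linear_combination[OF permutes_inv_shuffle[OF that] assms(2,3)])
  then show ?thesis
    unfolding shuffle_sum_def scale_sum_right sum.distrib[symmetric]
    by (intro sum.cong) (simp_all add: scale_right_distrib mult.commute)
qed

lemma shuffle_sum_add_left:
  assumes "x \<in> Op p u" "x' \<in> Op p u" "y \<in> Op q v"
  shows "shuffle_sum p q (x + x') y = shuffle_sum p q x y + shuffle_sum p q x' y"
  using shuffle_sum_linear_combination[of p "x + x'" y 1 x y 1 x' y q "u + v"] assms
  by (simp add: odot_add_left odot_closed)

lemma shuffle_sum_add_right:
  assumes "x \<in> Op p u" "y \<in> Op q v" "y' \<in> Op q v"
  shows "shuffle_sum p q x (y + y') = shuffle_sum p q x y + shuffle_sum p q x y'"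
  using shuffle_sum_linear_combination[of p x "y + y'" 1 x y 1 x y' q "u + v"] assms
  by (simp add: odot_add_right odot_closed)

lemma shuffle_sum_scale_left:
  assumes "x \<in> Op p u" "y \<in> Op q v"
  shows "shuffle_sum p q (scale c x) y = scale c (shuffle_sum p q x y)"
  using shuffle_sum_linear_combination[of p "scale c x" y c x y 0 x y q "u + v"] assms
  by (simp add: odot_scale_left odot_closed)

lemma shuffle_sum_scale_right:
  assumes "x \<in> Op p u" "y \<in> Op q v"
  shows "shuffle_sum p q x (scale c y) = scale c (shuffle_sum p q x y)"
  using shuffle_sum_linear_combination[of p x "scale c y" c x y 0 x y q "u + v"] assms
  by (simp add: odot_scale_right odot_closed)

lemma d_shuffle_sum:
  assumes x: "x \<in> Op p u" and y: "y \<in> Op q v"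
  shows "d (shuffle_sum p q x y) =
    shuffle_sum p q (d x) y + scale ((-1) ^ u) (shuffle_sum p q x (d y))"
proof -
  \<comment> \<open>The action is additive only within one summand, so both terms must share a
    degree. For \<open>u = 0\<close> the degree from \<open>d_closed\<close> would be
    \<open>v\<close>, but then \<open>d x = 0\<close> and the term vanishes; the second term is
    symmetric.\<close>
  have 1: "odot p (d x) y \<in> Op (p + q) (u + v - 1)"
    using odot_closed[OF d_closed[OF x] y] d_degree_0[of x p] x odot_zero(1)[OF y, of p]
    by (cases u) auto
  have 2: "odot p x (d y) \<in> Op (p + q) (u + v - 1)"
    using odot_closed[OF x d_closed[OF y]] d_degree_0[of y q] y odot_zero(2)[OF x]
    by (cases v) auto
  have "d (act (odot p x y) (inv \<sigma>)) =
      act (odot p (d x) y) (inv \<sigma>) + scale ((-1) ^ u) (act (odot p x (d y)) (inv \<sigma>))"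
    if "\<sigma> \<in> shuffle_perms p q" for \<sigma>
    using act_linear_combination[OF permutes_inv_shuffle[OF that] 1 2, of 1 "(-1) ^ u"]
      d_act[OF permutes_inv_shuffle[OF that] odot_closed[OF x y]]
    by (simp add: d_odot[OF x y])
  then show ?thesis
    unfolding shuffle_sum_def d_sum d_scale scale_sum_right sum.distrib[symmetric]
    by (intro sum.cong) (simp_all add: scale_right_distrib mult.commute)
qed

section \<open>Associativity of shuffle sums\<close>

text \<open>For a right action, acting by \<open>inv \<tau>\<close> and then by
  \<open>inv \<sigma>\<close> is acting by \<open>inv \<tau> \<circ> inv \<sigma> = inv (\<sigma>
  \<circ> \<tau>)\<close>. Iterated shuffle sums therefore involve exactly the composites of the
  factorisation.\<close>

lemma signed_act_comp:
  assumes "W \<in> Op n k" "\<sigma> permutes {1..n}" "\<tau> permutes {1..n}"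
  shows "scale (of_int (sign \<sigma>)) (scale (of_int (sign \<tau>)) (act (act W (inv \<tau>)) (inv \<sigma>))) =
    scale (of_int (sign (\<sigma> \<circ> \<tau>))) (act W (inv (\<sigma> \<circ> \<tau>)))"
proof -
  have "permutation \<sigma>" "permutation \<tau>"
    using assms(2,3) permutation_permutes by blast+
  moreover have "inv (\<sigma> \<circ> \<tau>) = inv \<tau> \<circ> inv \<sigma>"
    using assms(2,3) by (intro o_inv_distrib permutes_bij)
  moreover have "act (act W (inv \<tau>)) (inv \<sigma>) = act W (inv \<tau> \<circ> inv \<sigma>)"
    by (rule act_act[OF permutes_inv permutes_inv assms(1)]) (fact assms)+
  ultimately show ?thesis
    by (simp add: sign_compose)
qed

lemma shuffle_sum_left_nested:
  assumes x: "x \<in> Op p u" and y: "y \<in> Op q v" and z: "z \<in> Op r w"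
  shows "shuffle_sum (p + q) r (shuffle_sum p q x y) z =
    (\<Sum>\<rho>\<in>shuffle_perms3 p q r.
      scale (of_int (sign \<rho>)) (act (odot (p + q) (odot p x y) z) (inv \<rho>)))"
proof -
  define W where "W = odot (p + q) (odot p x y) z"
  note xy = odot_closed[OF x y]
  have W: "W \<in> Op (p + q + r) (u + v + w)"
    unfolding W_def by (rule odot_closed[OF xy z])
  \<comment> \<open>The inner shuffle also acts on the triple product, fixing the inputs of
    \<open>z\<close>.\<close>
  have \<tau>': "\<tau> permutes {1..p + q + r}" if "\<tau> \<in> shuffle_perms p q" for \<tau>
    using shuffle_permsD[OF that] by (rule permutes_subset) simp
  have "odot (p + q) (shuffle_sum p q x y) z =
      (\<Sum>\<tau>\<in>shuffle_perms p q. scale (of_int (sign \<tau>)) (odot (p + q) (act (odot p x y) (inv \<tau>)) z))"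
    unfolding shuffle_sum_def
    by (rule hom_on_subspace_sum[OF subspace_Op[of "p + q" "u + v"]])
      (auto intro!: odot_add_left odot_scale_left z act_closed xy permutes_inv_shuffle)
  also have "\<dots> = (\<Sum>\<tau>\<in>shuffle_perms p q. scale (of_int (sign \<tau>)) (act W (inv \<tau>)))"
    unfolding W_def by (simp add: odot_act_left[OF xy z permutes_inv_shuffle])
  finally have *: "odot (p + q) (shuffle_sum p q x y) z =
    (\<Sum>\<tau>\<in>shuffle_perms p q. scale (of_int (sign \<tau>)) (act W (inv \<tau>)))" .
  have "act (odot (p + q) (shuffle_sum p q x y) z) (inv \<sigma>) =
      (\<Sum>\<tau>\<in>shuffle_perms p q. scale (of_int (sign \<tau>)) (act (act W (inv \<tau>)) (inv \<sigma>)))"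
    if "\<sigma> \<in> shuffle_perms (p + q) r" for \<sigma>
    unfolding *
    by (rule hom_on_subspace_sum[OF subspace_Op[of "p + q + r" "u + v + w"]])
      (auto intro!: act_add act_scale act_closed W permutes_inv_shuffle[OF that]
        permutes_inv[OF \<tau>'])
  then have "shuffle_sum (p + q) r (shuffle_sum p q x y) z =
      (\<Sum>\<sigma>\<in>shuffle_perms (p + q) r. \<Sum>\<tau>\<in>shuffle_perms p q.
        scale (of_int (sign (\<sigma> \<circ> \<tau>))) (act W (inv (\<sigma> \<circ> \<tau>))))"
    unfolding shuffle_sum_def[of "p + q"]
    by (simp add: scale_sum_right signed_act_comp[OF W shuffle_permsD \<tau>'] del: scale_scale)
  also have "\<dots> = (\<Sum>(\<sigma>, \<tau>)\<in>shuffle_perms (p + q) r \<times> shuffle_perms p q.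
        scale (of_int (sign (\<sigma> \<circ> \<tau>))) (act W (inv (\<sigma> \<circ> \<tau>))))"
    by (rule sum.cartesian_product)
  also have "\<dots> = (\<Sum>\<rho>\<in>shuffle_perms3 p q r. scale (of_int (sign \<rho>)) (act W (inv \<rho>)))"
    by (subst sum.reindex_bij_betw[OF bij_betw_shuffle_perms3_left, symmetric])
      (simp add: case_prod_beta')
  finally show ?thesis unfolding W_def .
qed

lemma shuffle_sum_right_nested:
  assumes x: "x \<in> Op p u" and y: "y \<in> Op q v" and z: "z \<in> Op r w"
  shows "shuffle_sum p (q + r) x (shuffle_sum q r y z) =
    (\<Sum>\<rho>\<in>shuffle_perms3 p q r.
      scale (of_int (sign \<rho>)) (act (odot p x (odot q y z)) (inv \<rho>)))"
proof -
  define W where "W = odot p x (odot q y z)"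
  note yz = odot_closed[OF y z]
  have W: "W \<in> Op (p + (q + r)) (u + (v + w))"
    unfolding W_def by (rule odot_closed[OF x yz])
  let ?s = "shift_perm p (q + r)"
  have \<tau>': "?s \<tau> permutes {1..p + (q + r)}" if "\<tau> \<in> shuffle_perms q r" for \<tau>
    using shift_perm_permutes[OF shuffle_permsD[OF that]] by (rule permutes_subset) simp
  have "odot p x (shuffle_sum q r y z) =
      (\<Sum>\<tau>\<in>shuffle_perms q r. scale (of_int (sign \<tau>)) (odot p x (act (odot q y z) (inv \<tau>))))"
    unfolding shuffle_sum_def
    by (rule hom_on_subspace_sum[OF subspace_Op[of "q + r" "v + w"]])
      (auto intro!: odot_add_right odot_scale_right x act_closed yz permutes_inv_shuffle)
  \<comment> \<open>The sign and the inverse are both expressed through the shifted permutation, so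
    that it can be composed with the outer shuffle.\<close>
  also have "\<dots> = (\<Sum>\<tau>\<in>shuffle_perms q r. scale (of_int (sign (?s \<tau>))) (act W (inv (?s \<tau>))))"
    unfolding W_def
    by (simp add: odot_act_right[OF x yz permutes_inv_shuffle] sign_shift_perm[OF shuffle_permsD]
        inv_shift_perm[OF shuffle_permsD])
  finally have *: "odot p x (shuffle_sum q r y z) =
    (\<Sum>\<tau>\<in>shuffle_perms q r. scale (of_int (sign (?s \<tau>))) (act W (inv (?s \<tau>))))" .
  have "act (odot p x (shuffle_sum q r y z)) (inv \<sigma>) =
      (\<Sum>\<tau>\<in>shuffle_perms q r.
        scale (of_int (sign (?s \<tau>))) (act (act W (inv (?s \<tau>))) (inv \<sigma>)))"
    if "\<sigma> \<in> shuffle_perms p (q + r)" for \<sigma>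
    unfolding *
    by (rule hom_on_subspace_sum[OF subspace_Op[of "p + (q + r)" "u + (v + w)"]])
      (auto intro!: act_add act_scale act_closed W permutes_inv_shuffle[OF that]
        permutes_inv[OF \<tau>'])
  then have "shuffle_sum p (q + r) x (shuffle_sum q r y z) =
      (\<Sum>\<sigma>\<in>shuffle_perms p (q + r). \<Sum>\<tau>\<in>shuffle_perms q r.
        scale (of_int (sign (\<sigma> \<circ> ?s \<tau>))) (act W (inv (\<sigma> \<circ> ?s \<tau>))))"
    unfolding shuffle_sum_def[of p]
    by (simp add: scale_sum_right signed_act_comp[OF W shuffle_permsD \<tau>'] del: scale_scale)
  also have "\<dots> = (\<Sum>(\<sigma>, \<tau>)\<in>shuffle_perms p (q + r) \<times> shuffle_perms q r.
        scale (of_int (sign (\<sigma> \<circ> ?s \<tau>))) (act W (inv (\<sigma> \<circ> ?s \<tau>))))"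
    by (rule sum.cartesian_product)
  also have "\<dots> = (\<Sum>\<rho>\<in>shuffle_perms3 p q r. scale (of_int (sign \<rho>)) (act W (inv \<rho>)))"
    by (subst sum.reindex_bij_betw[OF bij_betw_shuffle_perms3_right, symmetric])
      (simp add: case_prod_beta')
  finally show ?thesis unfolding W_def .
qed

lemma shuffle_sum_assoc:
  assumes "x \<in> Op p u" "y \<in> Op q v" "z \<in> Op r w"
  shows "shuffle_sum (p + q) r (shuffle_sum p q x y) z =
    shuffle_sum p (q + r) x (shuffle_sum q r y z)"
  using assms by (simp add: shuffle_sum_left_nested shuffle_sum_right_nested odot_assoc)

lemma shuffle_product_eq_shuffle_sum:
  assumes "x \<in> Op p u" "y \<in> Op q v"
  shows "shuffle_product x y = shuffle_sum p q x y"
  using shuffle_product_homogeneous[OF assms] unfolding shuffle_sum_def .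

section \<open>Bilinear extension to the total space\<close>

abbreviation "part \<equiv> components (\<lambda>(n, r). Op n r)"

lemma part_in: "part x (n, r) \<in> Op n r"
  using components_in[OF direct_sum, of x "(n, r)"] by simp

text \<open>Terms outside the supports vanish, so the index sets may be enlarged. Products of
  vectors with different supports can then be added termwise over a common index set.\<close>

lemma shuffle_product_eq_sum:
  assumes I: "finite I" "{i. part x i \<noteq> 0} \<subseteq> I" and J: "finite J" "{j. part y j \<noteq> 0} \<subseteq> J"
  shows "shuffle_product x y =
    (\<Sum>(p, u)\<in>I. \<Sum>(q, v)\<in>J. shuffle_sum p q (part x (p, u)) (part y (q, v)))"
proof -
  have zero: "shuffle_sum p q (part x (p, u)) (part y (q, v)) = 0"
    if "part x (p, u) = 0 \<or> part y (q, v) = 0" for p u q v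
    by (rule shuffle_sum_zero[OF part_in part_in that])
  have "shuffle_product x y = (\<Sum>(p, u)\<in>{i. part x i \<noteq> 0}. \<Sum>(q, v)\<in>J.
      shuffle_sum p q (part x (p, u)) (part y (q, v)))"
    unfolding shuffle_product_def Let_def
  proof (intro sum.cong refl, clarify)
    fix p u
    show "(\<Sum>(q, v)\<in>{j. part y j \<noteq> 0}. shuffle_sum p q (part x (p, u)) (part y (q, v))) =
        (\<Sum>(q, v)\<in>J. shuffle_sum p q (part x (p, u)) (part y (q, v)))"
      by (rule sum.mono_neutral_left[OF J]) (auto intro: zero)
  qed
  also have "\<dots> = (\<Sum>(p, u)\<in>I. \<Sum>(q, v)\<in>J. shuffle_sum p q (part x (p, u)) (part y (q, v)))"
    by (rule sum.mono_neutral_left[OF I]) (auto intro!: sum.neutral zero)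
  finally show ?thesis .
qed

lemma shuffle_product_add_left:
  "shuffle_product (x + x') y = shuffle_product x y + shuffle_product x' y"
proof -
  let ?I = "{i. part x i \<noteq> 0} \<union> {i. part x' i \<noteq> 0}" and ?J = "{j. part y j \<noteq> 0}"
  have fin: "finite ?I" "finite ?J" using finite_components[OF direct_sum] by auto
  have "{i. part (x + x') i \<noteq> 0} \<subseteq> ?I" by (auto simp: components_add[OF direct_sum])
  then have "shuffle_product (x + x') y = (\<Sum>(p, u)\<in>?I. \<Sum>(q, v)\<in>?J.
      shuffle_sum p q (part x (p, u)) (part y (q, v)) +
      shuffle_sum p q (part x' (p, u)) (part y (q, v)))"
    by (simp add: shuffle_product_eq_sum[OF fin(1) _ fin(2)] components_add[OF direct_sum]
        shuffle_sum_add_left[OF part_in part_in part_in])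
  also have "\<dots> = shuffle_product x y + shuffle_product x' y"
    by (simp add: shuffle_product_eq_sum[OF fin(1) _ fin(2)] case_prod_beta' sum.distrib)
  finally show ?thesis .
qed

lemma shuffle_product_add_right:
  "shuffle_product x (y + y') = shuffle_product x y + shuffle_product x y'"
proof -
  let ?I = "{i. part x i \<noteq> 0}" and ?J = "{j. part y j \<noteq> 0} \<union> {j. part y' j \<noteq> 0}"
  have fin: "finite ?I" "finite ?J" using finite_components[OF direct_sum] by auto
  have "{i. part (y + y') i \<noteq> 0} \<subseteq> ?J" by (auto simp: components_add[OF direct_sum])
  then have "shuffle_product x (y + y') = (\<Sum>(p, u)\<in>?I. \<Sum>(q, v)\<in>?J.
      shuffle_sum p q (part x (p, u)) (part y (q, v)) +
      shuffle_sum p q (part x (p, u)) (part y' (q, v)))"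
    by (simp add: shuffle_product_eq_sum[OF fin(1) _ fin(2)] components_add[OF direct_sum]
        shuffle_sum_add_right[OF part_in part_in part_in])
  also have "\<dots> = shuffle_product x y + shuffle_product x y'"
    by (simp add: shuffle_product_eq_sum[OF fin(1) _ fin(2)] case_prod_beta' sum.distrib)
  finally show ?thesis .
qed

lemma shuffle_product_scale_left: "shuffle_product (scale c x) y = scale c (shuffle_product x y)"
proof -
  let ?I = "{i. part x i \<noteq> 0}" and ?J = "{j. part y j \<noteq> 0}"
  have fin: "finite ?I" "finite ?J" using finite_components[OF direct_sum] by auto
  have "{i. part (scale c x) i \<noteq> 0} \<subseteq> ?I" by (auto simp: components_scale[OF direct_sum])
  then have "shuffle_product (scale c x) y = (\<Sum>(p, u)\<in>?I. \<Sum>(q, v)\<in>?J.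
      scale c (shuffle_sum p q (part x (p, u)) (part y (q, v))))"
    by (simp add: shuffle_product_eq_sum[OF fin(1) _ fin(2)] components_scale[OF direct_sum]
        shuffle_sum_scale_left[OF part_in part_in])
  also have "\<dots> = scale c (shuffle_product x y)"
    by (simp add: shuffle_product_eq_sum[OF fin(1) _ fin(2)] case_prod_beta' scale_sum_right)
  finally show ?thesis .
qed

lemma shuffle_product_scale_right: "shuffle_product x (scale c y) = scale c (shuffle_product x y)"
proof -
  let ?I = "{i. part x i \<noteq> 0}" and ?J = "{j. part y j \<noteq> 0}"
  have fin: "finite ?I" "finite ?J" using finite_components[OF direct_sum] by auto
  have "{i. part (scale c y) i \<noteq> 0} \<subseteq> ?J" by (auto simp: components_scale[OF direct_sum])
  then have "shuffle_product x (scale c y) = (\<Sum>(p, u)\<in>?I. \<Sum>(q, v)\<in>?J.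
      scale c (shuffle_sum p q (part x (p, u)) (part y (q, v))))"
    by (simp add: shuffle_product_eq_sum[OF fin(1) _ fin(2)] components_scale[OF direct_sum]
        shuffle_sum_scale_right[OF part_in part_in])
  also have "\<dots> = scale c (shuffle_product x y)"
    by (simp add: shuffle_product_eq_sum[OF fin(1) _ fin(2)] case_prod_beta' scale_sum_right)
  finally show ?thesis .
qed

lemma shuffle_product_zero: "shuffle_product 0 y = 0" "shuffle_product x 0 = 0"
  using shuffle_product_scale_left[of 0 0 y] shuffle_product_scale_right[of x 0 0] by simp_all

lemmas shuffle_product_bilinear =
  shuffle_product_add_left shuffle_product_add_right shuffle_product_scale_left
  shuffle_product_scale_right shuffle_product_zero

lemma shuffle_product_closed:
  assumes "x \<in> Op p u" "y \<in> Op q v"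
  shows "shuffle_product x y \<in> Op (p + q) (u + v)"
  using shuffle_sum_closed[OF assms] by (simp add: shuffle_product_eq_shuffle_sum[OF assms])

lemma shuffle_product_assoc:
  "shuffle_product (shuffle_product x y) z = shuffle_product x (shuffle_product y z)"
proof (induction x rule: homogeneous_induct)
  case 1
  show ?case by (rule subspaceI) (simp_all add: shuffle_product_bilinear)
next
  case x: (2 p u x)
  show ?case
  proof (induction y rule: homogeneous_induct)
    case 1
    show ?case by (rule subspaceI) (simp_all add: shuffle_product_bilinear)
  next
    case y: (2 q v y)
    show ?case
    proof (induction z rule: homogeneous_induct)
      case 1
      show ?case by (rule subspaceI) (simp_all add: shuffle_product_bilinear)
    next
      case z: (2 r w z)
      show ?case
        using shuffle_sum_assoc[OF x y z]
        by (simp add: shuffle_product_eq_shuffle_sum[OF x y] shuffle_product_eq_shuffle_sum[OF y z]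
            shuffle_product_eq_shuffle_sum[OF shuffle_sum_closed[OF x y] z]
            shuffle_product_eq_shuffle_sum[OF x shuffle_sum_closed[OF y z]])
    qed
  qed
qed

lemma shuffle_product_degree:
  assumes "x \<in> degree_part r" "y \<in> degree_part s"
  shows "shuffle_product x y \<in> degree_part (r + s)"
  using assms(1)
proof (induction rule: degree_part_induct)
  case 1
  show ?case
    by (rule subspaceI) (simp_all add: shuffle_product_bilinear subspace_degree_part
        subspace_0 subspace_add subspace_scale)
next
  case x: (2 p x)
  show ?case
    using assms(2)
  proof (induction rule: degree_part_induct)
    case 1
    show ?case
      by (rule subspaceI) (simp_all add: shuffle_product_bilinear subspace_degree_part
          subspace_0 subspace_add subspace_scale)
  next
    case (2 q y)
    then show ?case using shuffle_product_closed[OF x] Op_subset_degree_part by blast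
  qed
qed

text \<open>The sign depends only on the degree of \<open>x\<close>, so \<open>x\<close> ranges over
  one degree with mixed arities, while \<open>y\<close> is arbitrary and decomposed in both.\<close>

lemma d_shuffle_product:
  assumes "x \<in> degree_part r"
  shows "d (shuffle_product x y) =
    shuffle_product (d x) y + scale ((-1) ^ r) (shuffle_product x (d y))"
  using assms
proof (induction rule: degree_part_induct)
  case 1
  show ?case
    by (rule subspaceI) (simp_all add: shuffle_product_bilinear d_add d_scale d_zero
        scale_right_distrib add_ac mult.commute)
next
  case x: (2 p x)
  show ?case
  proof (induction y rule: homogeneous_induct)
    case 1
    show ?case
      by (rule subspaceI) (simp_all add: shuffle_product_bilinear d_add d_scale d_zero
          scale_right_distrib add_ac mult.commute)
  next
    case y: (2 q v y)
    show ?case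
      using d_shuffle_sum[OF x y]
      by (simp add: shuffle_product_eq_shuffle_sum[OF x y]
          shuffle_product_eq_shuffle_sum[OF d_closed[OF x] y]
          shuffle_product_eq_shuffle_sum[OF x d_closed[OF y]])
  qed
qed

end

section \<open>The unit and the dg algebra structure\<close>

context free_cosimplicial_sigma_dg_operad
begin

lemma base_point_closed: "base_point \<in> Op 0 0"
  unfolding base_point_def by (rule eta_closed)

text \<open>Inserting the base point into either input of \<open>mu\<close> leaves the operad unit.
  On the right, parallel associativity first exchanges \<open>x\<close> and the base point, without
  sign because the latter has degree 0.\<close>

lemma odot_base_point:
  assumes "x \<in> Op p u"
  shows "odot 0 base_point x = x" "odot p x base_point = x"
proof -
  show "odot 0 base_point x = x"
    unfolding odot_def mu_base_left using unit_left[OF assms] by simp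
  have "odot p x base_point = comp (comp mu 2 base_point) 1 x"
    unfolding odot_def using assoc_par[OF _ _ _ mu_closed assms base_point_closed, of 1 2] by simp
  then show "odot p x base_point = x"
    unfolding mu_base_right using unit_left[OF assms] by simp
qed

text \<open>The base point has arity 0, so only the identity shuffle occurs and the claim reduces to
  \<open>odot\<close>. The algebra unit is thus the base point, not the operad unit of arity
  1.\<close>

lemma shuffle_product_base_point: "shuffle_product base_point x = x" "shuffle_product x base_point = x"
proof -
  show "shuffle_product base_point x = x"
  proof (induction x rule: homogeneous_induct)
    case 1
    show ?case by (rule subspaceI) (simp_all add: shuffle_product_bilinear)
  next
    case x: (2 p u x)
    show ?case
      by (simp add: shuffle_product_homogeneous[OF base_point_closed x] shuffle_perms_0
          odot_base_point[OF x] act_id[OF x])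
  qed
  show "shuffle_product x base_point = x"
  proof (induction x rule: homogeneous_induct)
    case 1
    show ?case by (rule subspaceI) (simp_all add: shuffle_product_bilinear)
  next
    case x: (2 p u x)
    show ?case
      by (simp add: shuffle_product_homogeneous[OF x base_point_closed] shuffle_perms_0
          odot_base_point[OF x] act_id[OF x])
  qed
qed

lemma dg_algebra_shuffle_product: "dg_algebra scale degree_part shuffle_product base_point d"
proof (intro dg_algebra.intro dg_algebra_axioms.intro)
  show "internal_direct_sum degree_part" by (rule internal_direct_sum_degree_part)
  show "Vector_Spaces.linear scale scale (\<lambda>y. shuffle_product x y)"
    "Vector_Spaces.linear scale scale (\<lambda>y. shuffle_product y x)" for x
    by (simp_all add: Vector_Spaces.linear_iff vector_space_axioms shuffle_product_bilinear)
  show "base_point \<in> degree_part 0"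
    by (rule Op_subset_degree_part[OF base_point_closed])
  \<comment> \<open>Degree conditions known on each arity pass to the span over all arities by
    linearity of \<open>d\<close>.\<close>
  show "d x \<in> degree_part r" if "x \<in> degree_part (Suc r)" for x r
    using that
  proof (induction rule: degree_part_induct)
    case 1
    show ?case
      by (rule subspaceI) (simp_all add: d_add d_scale d_zero subspace_degree_part
          subspace_0 subspace_add subspace_scale)
  qed (use d_degree Op_subset_degree_part in blast)
  show "d x = 0" if "x \<in> degree_part 0" for x
    using that
  proof (induction rule: degree_part_induct)
    case 1
    show ?case by (rule subspaceI) (simp_all add: d_add d_scale d_zero)
  qed (rule d_degree_0)
qed (simp_all add: vector_space_axioms shuffle_product_assoc shuffle_product_base_point shuffle_product_degree
    d_linear d_square d_shuffle_product)

end

theorem proposition3p4: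
  fixes scale :: "'k::field \<Rightarrow> 'a::ab_group_add \<Rightarrow> 'a"
    and Op :: "nat \<Rightarrow> nat \<Rightarrow> 'a set"
    and d :: "'a \<Rightarrow> 'a"
    and act :: "'a \<Rightarrow> (nat \<Rightarrow> nat) \<Rightarrow> 'a"
    and comp :: "'a \<Rightarrow> nat \<Rightarrow> 'a \<Rightarrow> 'a"
    and unit mu :: "'a"
    and eta :: "'k \<Rightarrow> 'a"
    and gens :: "nat \<Rightarrow> nat \<Rightarrow> 'a set"
  assumes "free_cosimplicial_sigma_dg_operad scale Op d act comp unit mu eta gens"
  shows "let nabla = multiplicative_sigma_dg_operad.shuffle_product scale Op act comp mu;
             base = pointed_sigma_dg_operad.base_point eta;
             degree_part = sigma_dg_operad.degree_part scale Op
         in (\<forall>p q u v. \<forall>x\<in>Op p u. \<forall>y\<in>Op q v. nabla x y \<in> Op (p + q) (u + v)) \<and>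
            dg_algebra scale degree_part nabla base d"
proof -
  interpret free_cosimplicial_sigma_dg_operad scale Op d act comp unit mu eta gens
    by (fact assms)
  show ?thesis
    using shuffle_product_closed dg_algebra_shuffle_product unfolding Let_def by blast
qed

end
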